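(* For $A,B,C\in\widehat{\mathbb{F}_q^{*}}$, the value of $$ {}_{3}F_2\!\left(\begin{array}{ccc} A, & B, & C\\ & A\bar{B}, & A\bar{C}\end{array}\Big|\;1\right)_q^{\star} $$ is: (i) $0$ if $A$ is not a square; (ii) $\displaystyle\sum_{R^2=A}\frac{g(\bar{A}BC)\,g(\bar{R}B)\,g(\bar{R}C)\,g(R)\,g(R\,\overline{BC})}{g(\bar{A}B)\,g(\bar{A}C)\,g(A)\,(BC)(-1)\,q}$ if $A$ is a square and $(BC)^2\neq A$, or if $(BC)^2=A\neq BC$, $B\neq\varepsilon$, $C\neq\varepsilon$; (iii) $-q+3$ if $(BC)^2=A\neq BC$, $A\neq\varepsilon$ and $B=\varepsilon$ or $C=\varepsilon$, or if $A=\varepsilon$, $C=\bar{B}$, $B\neq\varepsilon$, $B\neq\phi$; (iv) $-q^2+2q+1$ if $A=\varepsilon$, $BC=\phi$, and $B=\varepsilon$ or $B=\phi$; (v) $-q^3+q^2+q+1$ if $A=B=C=\varepsilon$; (vi) $\dfrac{-q^2+2q+1}{q}$ if $A=\varepsilon$, $B=C=\phi$.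
   Context: Let $q$ be a prime power and $\mathbb{F}_q$ the finite field with $q$ elements. $\widehat{\mathbb{F}_q^{*}}$ denotes the group of multiplicative characters of $\mathbb{F}_q^{*}$; every character $\chi$ (including the trivial character $\varepsilon$) is extended to $\mathbb{F}_q$ by $\chi(0):=0$. $\bar{\chi}$ denotes the inverse character, and juxtaposition denotes pointwise product of characters. $\phi$ denotes the character of order $2$ (when $q$ is odd). Fix a non-trivial additive character $\theta$ of $\mathbb{F}_q$ and define the Gauss sum $g(\chi):=\sum_{x\in\mathbb{F}_q}\chi(x)\theta(x)$. For $A_0,A_1,A_2,B_1,B_2\in\widehat{\mathbb{F}_q^{*}}$ and $x\in\mathbb{F}_q$ define $$ {}_{3}F_2\!\left(\begin{array}{ccc} A_0, & A_1, & A_2\\ & B_1, & B_2\end{array}\Big|\;x\right)_q^{\star}:=\frac{1}{q-1}\sum_{\chi\in\widehat{\mathbb{F}_q^{*}}}\prod_{i=0}^{2}\frac{g(A_i\chi)}{g(A_i)}\prod_{j=1}^{2}\frac{g(\overline{B_j\chi})}{g(\overline{B_j})}\,g(\bar{\chi})\,\chi(-1)\chi(x). $$ "$A$ is a square" means $A=S^2$ for some character $S$; $\sum_{R^2=A}$ denotes the sum over all characters $R$ with $R^2=A$.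
   Formalization: Case (ii) is stated for odd q only, since it fails for even q (e.g. q=4, A=B=ε, C of order 3: the value is 5, the formula gives 1); the other cases are stated for every prime power q. *)

theory Defs
  imports Complex_Main "HOL-Library.Cardinality"
begin

text \<open>
  The finite field is an arbitrary type of sort \<open>{field, finite}\<close>, and \<open>q\<close> is \<open>CARD('a)\<close>.
  A multiplicative character is a homomorphism from the nonzero elements into the nonzero complex
  numbers, represented by its extension by \<open>0\<close> to the whole field (also for the trivial character).
\<close>

definition mult_char :: "('a::{field,finite} \<Rightarrow> complex) \<Rightarrow> bool" where
  "mult_char \<chi> \<longleftrightarrow> \<chi> 0 = 0 \<and> (\<forall>x. x \<noteq> 0 \<longrightarrow> \<chi> x \<noteq> 0) \<and>
     (\<forall>x y. x \<noteq> 0 \<longrightarrow> y \<noteq> 0 \<longrightarrow> \<chi> (x * y) = \<chi> x * \<chi> y)"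

definition trivial_char :: "'a::{field,finite} \<Rightarrow> complex" (\<open>\<epsilon>\<close>) where
  "\<epsilon> = (\<lambda>x. if x = 0 then 0 else 1)"

definition char_mult ::
  "('a::{field,finite} \<Rightarrow> complex) \<Rightarrow> ('a \<Rightarrow> complex) \<Rightarrow> 'a \<Rightarrow> complex"
  (infixl \<open>\<cdot>\<^sub>c\<close> 70) where
  "A \<cdot>\<^sub>c B = (\<lambda>x. A x * B x)"

text \<open>Here \<open>inverse 0 = 0\<close> gives the extension by zero of the inverse character.\<close>

definition char_inv :: "('a::{field,finite} \<Rightarrow> complex) \<Rightarrow> 'a \<Rightarrow> complex" where
  "char_inv A = (\<lambda>x. inverse (A x))"

text \<open>
  Such a \<open>\<phi>\<close> is unique, and it exists iff \<open>q\<close> is odd.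
\<close>

definition order_two_char :: "('a::{field,finite} \<Rightarrow> complex) \<Rightarrow> bool" where
  "order_two_char \<phi> \<longleftrightarrow> mult_char \<phi> \<and> \<phi> \<noteq> \<epsilon> \<and> \<phi> \<cdot>\<^sub>c \<phi> = \<epsilon>"

definition square_char :: "('a::{field,finite} \<Rightarrow> complex) \<Rightarrow> bool" where
  "square_char A \<longleftrightarrow> (\<exists>S. mult_char S \<and> A = S \<cdot>\<^sub>c S)"

definition add_char :: "('a::{field,finite} \<Rightarrow> complex) \<Rightarrow> bool" where
  "add_char \<theta> \<longleftrightarrow> (\<forall>x. \<theta> x \<noteq> 0) \<and> (\<forall>x y. \<theta> (x + y) = \<theta> x * \<theta> y)"

definition nontrivial_add_char :: "('a::{field,finite} \<Rightarrow> complex) \<Rightarrow> bool" where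
  "nontrivial_add_char \<theta> \<longleftrightarrow> add_char \<theta> \<and> (\<exists>x. \<theta> x \<noteq> 1)"

definition gauss_sum ::
  "('a::{field,finite} \<Rightarrow> complex) \<Rightarrow> ('a \<Rightarrow> complex) \<Rightarrow> complex" where
  "gauss_sum \<theta> \<chi> = (\<Sum>x\<in>UNIV. \<chi> x * \<theta> x)"

definition hyp_3F2_star ::
  "('a::{field,finite} \<Rightarrow> complex) \<Rightarrow> ('a \<Rightarrow> complex) \<Rightarrow> ('a \<Rightarrow> complex) \<Rightarrow> ('a \<Rightarrow> complex) \<Rightarrow>
     ('a \<Rightarrow> complex) \<Rightarrow> ('a \<Rightarrow> complex) \<Rightarrow> 'a \<Rightarrow> complex" where
  "hyp_3F2_star \<theta> A\<^sub>0 A\<^sub>1 A\<^sub>2 B\<^sub>1 B\<^sub>2 x =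
     1 / (of_nat CARD('a) - 1) *
     (\<Sum>\<chi> | mult_char \<chi>.
        (gauss_sum \<theta> (A\<^sub>0 \<cdot>\<^sub>c \<chi>) / gauss_sum \<theta> A\<^sub>0) *
        (gauss_sum \<theta> (A\<^sub>1 \<cdot>\<^sub>c \<chi>) / gauss_sum \<theta> A\<^sub>1) *
        (gauss_sum \<theta> (A\<^sub>2 \<cdot>\<^sub>c \<chi>) / gauss_sum \<theta> A\<^sub>2) *
        (gauss_sum \<theta> (char_inv (B\<^sub>1 \<cdot>\<^sub>c \<chi>)) / gauss_sum \<theta> (char_inv B\<^sub>1)) *
        (gauss_sum \<theta> (char_inv (B\<^sub>2 \<cdot>\<^sub>c \<chi>)) / gauss_sum \<theta> (char_inv B\<^sub>2)) *
        gauss_sum \<theta> (char_inv \<chi>) * \<chi> (- 1) * \<chi> x)"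

lemma field_power_card_minus_1:
  fixes x :: "'a::{field,finite}"
  assumes "x \<noteq> 0"
  shows "x ^ (CARD('a) - 1) = 1"
proof -
  let ?U = "UNIV - {0 :: 'a}"
  have "bij_betw ((*) x) ?U ?U"
    using assms by (intro bij_betw_byWitness[where f' = "\<lambda>y. y / x"]) auto
  then have "(\<Prod>y\<in>?U. x * y) = (\<Prod>y\<in>?U. y)"
    by (rule prod.reindex_bij_betw)
  moreover have "(\<Prod>y\<in>?U. x * y) = x ^ (CARD('a) - 1) * (\<Prod>y\<in>?U. y)"
    by (simp add: prod.distrib card_Diff_singleton)
  ultimately show ?thesis
    by simp
qed

lemma mult_char_power:
  assumes "mult_char \<chi>" "x \<noteq> 0"
  shows "\<chi> (x ^ n) = \<chi> x ^ n"
proof (induction n)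
  case 0
  have "\<chi> (1 * 1) = \<chi> 1 * \<chi> 1" "\<chi> 1 \<noteq> 0"
    using assms(1) unfolding mult_char_def by (metis zero_neq_one)+
  then show ?case by simp
next
  case (Suc n)
  then show ?case using assms unfolding mult_char_def by simp
qed

text \<open>The sums over characters are genuine, since there are only finitely many characters.\<close>

lemma finite_mult_char: "finite {\<chi> :: 'a::{field,finite} \<Rightarrow> complex. mult_char \<chi>}"
proof -
  let ?n = "CARD('a) - 1"
  let ?V = "insert 0 {z :: complex. z ^ ?n = 1}"
  have "card {0, 1 :: 'a} \<le> CARD('a)"
    by (intro card_mono) auto
  then have "0 < ?n"
    by simp
  then have fin: "finite ?V"
    using finite_roots_unity[of ?n, where 'a = complex] by simp
  have "\<chi> x \<in> ?V" if \<chi>: "mult_char \<chi>" for \<chi> :: "'a \<Rightarrow> complex" and x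
  proof (cases "x = 0")
    case True
    with \<chi> show ?thesis by (simp add: mult_char_def)
  next
    case False
    have "\<chi> x ^ ?n = \<chi> 1"
      using mult_char_power[OF \<chi> False, of ?n] field_power_card_minus_1[OF False] by simp
    with mult_char_power[OF \<chi> False, of 0] show ?thesis by simp
  qed
  then have "{\<chi> :: 'a \<Rightarrow> complex. mult_char \<chi>} \<subseteq> {f. \<forall>x. (x \<in> UNIV \<longrightarrow> f x \<in> ?V) \<and> (x \<notin> UNIV \<longrightarrow> f x = 0)}"
    by auto
  moreover have "finite \<dots>"
    by (rule finite_set_of_finite_funs[OF finite_class.finite_UNIV fin])
  ultimately show ?thesis
    by (rule finite_subset)
qed

end

theory Submission
  imports Defs "HOL-Algebra.Algebraic_Closure_Type"
begin

text \<open>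
  The evaluation is the finite field shadow of the classical derivation of Dixon's theorem from those
  of Gauss and Kummer. Four of the six Gauss sums in the \<open>\<chi>\<close>-th term form the right hand side of
  Barnes' first lemma and are expanded into a sum over a further character \<open>\<psi>\<close>. After exchanging the
  sums, the sum over \<open>\<chi>\<close> is a \<open>\<^sub>2F\<^sub>1\<close> at \<open>-1\<close>, which Kummer's theorem evaluates as a sum over the
  characters \<open>R\<close> with \<open>R\<^sup>2 = A\<close>, and the sum over \<open>\<psi>\<close> that remains for each \<open>R\<close> is again one of
  Barnes' sums. All identities hold without restriction on the characters once the contributions of
  trivial characters are recorded; these are what distinguishes the exceptional cases.
\<close>

section \<open>The character group\<close>

lemma card_field_gt_1: "1 < CARD('a::{field,finite})"
proof -
  have "card {0, 1 :: 'a} \<le> CARD('a)"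
    by (intro card_mono) auto
  then show ?thesis by simp
qed

lemma card_nonzero: "card (- {0 :: 'a::{field,finite}}) = CARD('a) - 1"
  by (simp add: Compl_eq_Diff_UNIV card_Diff_singleton)

text \<open>The generator comes from HOL-Algebra through \<open>ring_of_type_algebra\<close>.
  Exponents reduce modulo q - 1, so q - 1 powers cover q - 1 nonzero elements; this forces
  injectivity.\<close>

lemma units_cyclic:
  obtains h :: "'a::{field,finite}" where "bij_betw (\<lambda>i. h ^ i) {..<CARD('a) - 1} (- {0})"
proof -
  let ?R = "ring_of_type_algebra :: 'a ring" and ?N = "CARD('a) - 1"
  interpret R: field ?R ..
  have pow: "a [^]\<^bsub>?R\<^esub> i = a ^ i" for a :: 'a and i :: nat
    by (induction i) (simp_all add: ring_of_type_algebra_def nat_pow_def mult.commute)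
  have car: "carrier (Multiplicative_Group.mult_of ?R) = - {0}"
    by (auto simp: Multiplicative_Group.mult_of_def ring_of_type_algebra_def)
  have "finite (carrier ?R)"
    by (rule finite_class.finite)
  then obtain h where "h \<in> carrier (Multiplicative_Group.mult_of ?R)"
      "carrier (Multiplicative_Group.mult_of ?R) = {h [^]\<^bsub>?R\<^esub> i | i :: nat. i \<in> UNIV}"
    by (rule bexE[OF R.finite_field_mult_group_has_gen])
  then have h: "h \<in> - {0}" "- {0} = {h ^ i | i :: nat. i \<in> UNIV}"
    unfolding car pow .
  then have h0: "h \<noteq> 0" by blast
  have N: "0 < ?N"
    using card_field_gt_1[where 'a = 'a] by simp
  have img: "(\<lambda>i. h ^ i) ` {..<?N} = - {0}"
  proof
    show "(\<lambda>i. h ^ i) ` {..<?N} \<subseteq> - {0}"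
      using h0 by auto
    show "- {0} \<subseteq> (\<lambda>i. h ^ i) ` {..<?N}"
    proof
      fix x assume "x \<in> - {0 :: 'a}"
      then obtain i where i: "x = h ^ i"
        using h(2) by auto
      have "h ^ i = h ^ (?N * (i div ?N) + i mod ?N)"
        by simp
      also have "\<dots> = h ^ (i mod ?N)"
        unfolding power_add power_mult field_power_card_minus_1[OF h0] by simp
      finally show "x \<in> (\<lambda>i. h ^ i) ` {..<?N}"
        using N i by auto
    qed
  qed
  have "inj_on (\<lambda>i. h ^ i) {..<?N}"
    using img card_nonzero[where 'a = 'a] by (intro eq_card_imp_inj_on) auto
  then show ?thesis
    using img that unfolding bij_betw_def by blast
qed

text \<open>The discrete logarithm to a generator, followed by an injection of Z/(q - 1) into the
  roots of unity, is a faithful character. A single character thus separates every x from 1.\<close>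

lemma mult_char_separates:
  fixes x :: "'a::{field,finite}"
  assumes "x \<noteq> 1" "x \<noteq> 0"
  obtains \<chi> :: "'a \<Rightarrow> complex" where "mult_char \<chi>" "\<chi> x \<noteq> 1"
proof -
  define N where "N = CARD('a) - 1"
  define w where "w = (\<lambda>k. cis (2 * pi * real k / real N))"
  have N: "0 < N"
    using card_field_gt_1[where 'a = 'a] by (simp add: N_def)
  obtain h :: 'a where h: "bij_betw (\<lambda>i. h ^ i) {..<N} (- {0})"
    unfolding N_def by (rule units_cyclic)
  define l where "l = inv_into {..<N} (\<lambda>i. h ^ i)"
  have l: "l y < N" "h ^ l y = y" if "y \<noteq> 0" for y
    using h that bij_betw_inv_into_right[OF h, of y] bij_betw_apply[OF bij_betw_inv_into[OF h], of y]
    by (auto simp: l_def)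
  have h0: "h \<noteq> 0"
  proof
    assume "h = 0"
    with l[OF assms(2)] assms show False by (cases "l x") auto
  qed
  have inj: "i = j" if "h ^ i = h ^ j" "i < N" "j < N" for i j
    using h that by (auto simp: bij_betw_def inj_on_def)
  have w_add: "w (i + j) = w i * w j" for i j
    by (simp add: w_def cis_mult distrib_left add_divide_distrib)
  have w_mod: "w (i mod N) = w i" for i
  proof -
    have "w (N * m) = 1" for m
      using N cis_multiple_2pi[of "real m"] by (simp add: w_def mult.assoc del: cis_multiple_2pi)
    then have "w (N * (i div N) + i mod N) = w (i mod N)"
      by (simp only: w_add mult_1)
    then show ?thesis by simp
  qed
  have h_mod: "h ^ (i mod N) = h ^ i" for i
  proof -
    have "h ^ (N * (i div N) + i mod N) = h ^ (i mod N)"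
      unfolding power_add power_mult N_def field_power_card_minus_1[OF h0] by simp
    then show ?thesis by simp
  qed
  \<comment> \<open>The discrete logarithm is additive only modulo \<open>N\<close>;
    \<open>w_mod\<close> later absorbs the reduction.\<close>
  have l_mult: "l (y * z) = (l y + l z) mod N" if "y \<noteq> 0" "z \<noteq> 0" for y z
    using that N by (intro inj) (simp_all add: h_mod power_add l)
  define \<chi> where "\<chi> y = (if y = 0 then 0 else w (l y))" for y
  have "mult_char \<chi>"
    unfolding mult_char_def \<chi>_def by (auto simp: l_mult w_mod w_add) (auto simp: w_def)
  moreover have "\<chi> x \<noteq> 1"
  proof
    assume "\<chi> x = 1"
    then have "w (l x) = w 0"
      using assms by (simp add: \<chi>_def w_def)
    then have "l x = 0"
      using bij_betw_roots_unity[OF N] l(1)[OF assms(2)] N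
      unfolding w_def bij_betw_def inj_on_def by blast
    with l(2)[OF assms(2)] assms show False by simp
  qed
  ultimately show ?thesis by (rule that)
qed

text \<open>
  The character group is written additively, so that identities between characters are settled
  by the simplification rules for abelian groups.
\<close>

typedef (overloaded) 'a mchar = "{\<chi> :: 'a::{field,finite} \<Rightarrow> complex. mult_char \<chi>}"
  morphisms ev mchar
  by (rule exI[of _ \<epsilon>]) (simp add: mult_char_def trivial_char_def)

setup_lifting type_definition_mchar

instantiation mchar :: ("{field,finite}") ab_group_add
begin

lift_definition zero_mchar :: "'a mchar" is \<epsilon>
  by (simp add: mult_char_def trivial_char_def)

lift_definition plus_mchar :: "'a mchar \<Rightarrow> 'a mchar \<Rightarrow> 'a mchar" is char_mult
  by (simp add: mult_char_def char_mult_def)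

lift_definition uminus_mchar :: "'a mchar \<Rightarrow> 'a mchar" is char_inv
  by (simp add: mult_char_def char_inv_def)

definition minus_mchar :: "'a mchar \<Rightarrow> 'a mchar \<Rightarrow> 'a mchar" where
  "minus_mchar a b = a + - b"

instance
proof
  fix a b c :: "'a mchar"
  show "a + b + c = a + (b + c)" "a + b = b + a"
    by (transfer; simp add: char_mult_def mult_ac)+
  show "0 + a = a"
    by transfer (auto simp: char_mult_def trivial_char_def mult_char_def)
  show "- a + a = 0"
    by transfer (auto simp: char_mult_def char_inv_def trivial_char_def mult_char_def)
  show "a - b = a + - b"
    by (rule minus_mchar_def)
qed

end

instance mchar :: ("{field,finite}") finite
proof
  have "range ev = {\<chi> :: 'a \<Rightarrow> complex. mult_char \<chi>}"
    using type_definition.Rep_range[OF type_definition_mchar] .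
  then have "finite (range (ev :: 'a mchar \<Rightarrow> _))"
    using finite_mult_char by simp
  then show "finite (UNIV :: 'a mchar set)"
    by (rule finite_imageD) (simp add: inj_on_def ev_inject)
qed

lemma ev_zero [simp]: "ev \<chi> 0 = 0"
  by transfer (simp add: mult_char_def)

lemma ev_eq_0_iff [simp]: "ev \<chi> x = 0 \<longleftrightarrow> x = 0"
  by transfer (auto simp: mult_char_def)

lemma ev_mult: "ev \<chi> (x * y) = ev \<chi> x * ev \<chi> y"
  by (cases "x = 0"; cases "y = 0"; transfer; simp add: mult_char_def)

lemma ev_one [simp]: "ev \<chi> 1 = 1"
  using ev_mult[of \<chi> 1 1] by simp

lemma ev_inverse: "ev \<chi> (inverse x) = inverse (ev \<chi> x)"
proof (cases "x = 0")
  case False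
  then have "ev \<chi> x * ev \<chi> (inverse x) = 1"
    by (simp flip: ev_mult)
  with False show ?thesis
    by (simp add: field_simps)
qed simp

lemma ev_divide: "ev \<chi> (x / y) = ev \<chi> x / ev \<chi> y"
  by (simp add: divide_inverse ev_mult ev_inverse)

lemma ev_0 [simp]: "ev 0 x = of_bool (x \<noteq> 0)"
  by transfer (simp add: trivial_char_def)

lemma ev_add: "ev (\<chi> + \<psi>) x = ev \<chi> x * ev \<psi> x"
  by transfer (simp add: char_mult_def)

lemma ev_uminus: "ev (- \<chi>) x = inverse (ev \<chi> x)"
  by transfer (simp add: char_inv_def)

lemma ev_diff: "ev (\<chi> - \<psi>) x = ev \<chi> x / ev \<psi> x"
  by (simp only: minus_mchar_def ev_add ev_uminus divide_inverse)

lemma ev_minus_one_squared [simp]: "ev \<chi> (- 1) * ev \<chi> (- 1) = 1"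
  by (simp flip: ev_mult)

lemma ev_minus_one_squared_left [simp]: "ev \<chi> (- 1) * (ev \<chi> (- 1) * z) = z"
  by (simp flip: mult.assoc)

lemma inverse_ev_minus_one [simp]: "inverse (ev \<chi> (- 1)) = ev \<chi> (- 1)"
  by (simp flip: ev_inverse)

section \<open>Orthogonality relations\<close>

lemma sum_mult_char:
  "(\<Sum>\<chi> | mult_char \<chi>. f \<chi>) = (\<Sum>\<chi>\<in>UNIV. f (ev \<chi>))"
  for f :: "('a::{field,finite} \<Rightarrow> complex) \<Rightarrow> 'b::comm_monoid_add"
proof -
  have "range ev = {\<chi> :: 'a \<Rightarrow> complex. mult_char \<chi>}"
    using type_definition.Rep_range[OF type_definition_mchar] .
  then show ?thesis
    by (intro sum.reindex_cong[of ev]) (simp_all add: inj_on_def ev_inject)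
qed

text \<open>Dilating the summation variable by some a with \<chi>(a) different from 1 multiplies the
  sum by \<chi>(a), so it vanishes for nontrivial \<chi>.\<close>

lemma sum_ev_field:
  "(\<Sum>x\<in>UNIV. ev \<chi> x) = (of_nat CARD('a) - 1) * of_bool (\<chi> = 0)"
  for \<chi> :: "'a::{field,finite} mchar"
proof (cases "\<chi> = 0")
  case True
  have "(\<Sum>x\<in>UNIV. ev \<chi> x) = (\<Sum>x\<in>- {0 :: 'a}. 1)"
    using True by (intro sum.mono_neutral_cong_right) auto
  with True card_nonzero[where 'a = 'a] card_field_gt_1[where 'a = 'a] show ?thesis
    by (simp add: of_nat_diff)
next
  case False
  then have "ev \<chi> \<noteq> ev 0"
    by (simp add: ev_inject)
  then obtain a where "ev \<chi> a \<noteq> ev 0 a"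
    by blast
  then have a: "a \<noteq> 0" "ev \<chi> a \<noteq> 1"
    by (cases "a = 0"; simp)+
  have "bij_betw ((*) a) UNIV UNIV"
    using a by (intro bij_betw_byWitness[where f' = "\<lambda>y. y / a"]) auto
  then have "(\<Sum>x\<in>UNIV. ev \<chi> (a * x)) = (\<Sum>x\<in>UNIV. ev \<chi> x)"
    by (rule sum.reindex_bij_betw)
  then have "ev \<chi> a * (\<Sum>x\<in>UNIV. ev \<chi> x) = (\<Sum>x\<in>UNIV. ev \<chi> x)"
    by (simp add: ev_mult sum_distrib_left)
  with a False show ?thesis by simp
qed

lemma sum_translate: "(\<Sum>\<chi>\<in>UNIV. f (\<alpha> + \<chi>)) = (\<Sum>\<chi>\<in>UNIV. f \<chi>)"
  for \<alpha> :: "'g::{ab_group_add,finite}"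
  by (rule sum.reindex_bij_betw) (rule bij_betw_byWitness[where f' = "\<lambda>y. y - \<alpha>"]; simp)

lemma sum_ev_mchar:
  fixes x :: "'a::{field,finite}"
  shows "(\<Sum>\<chi>\<in>UNIV. ev \<chi> x) = (of_nat CARD('a) - 1) * of_bool (x = 1)"
proof -
  have neq: "(\<Sum>\<chi>\<in>UNIV. ev \<chi> y) = 0" if "y \<noteq> 1" for y :: 'a
  proof (cases "y = 0")
    case False
    then obtain \<chi> :: "'a \<Rightarrow> complex" where "mult_char \<chi>" "\<chi> y \<noteq> 1"
      using mult_char_separates \<open>y \<noteq> 1\<close> by blast
    then obtain \<alpha> where \<alpha>: "ev \<alpha> y \<noteq> 1"
      by (metis mchar_inverse mem_Collect_eq)
    have "(\<Sum>\<chi>\<in>UNIV. ev (\<alpha> + \<chi>) y) = (\<Sum>\<chi>\<in>UNIV. ev \<chi> y)"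
      by (rule sum_translate)
    then have "ev \<alpha> y * (\<Sum>\<chi>\<in>UNIV. ev \<chi> y) = (\<Sum>\<chi>\<in>UNIV. ev \<chi> y)"
      by (simp add: ev_add sum_distrib_left)
    with \<alpha> show ?thesis by simp
  qed simp
  \<comment> \<open>The number of characters is found by double counting: summing over all y adds
    only zeros, and after the swap only the trivial character contributes.\<close>
  have "(\<Sum>\<chi>\<in>UNIV. ev \<chi> (1 :: 'a)) = (\<Sum>y\<in>UNIV. \<Sum>\<chi>\<in>UNIV. ev \<chi> (y :: 'a))"
    by (subst sum.remove[of UNIV "1 :: 'a"]) (auto intro!: sum.neutral neq)
  also have "\<dots> = (\<Sum>\<chi>\<in>UNIV. (of_nat CARD('a) - 1) * of_bool (\<chi> = (0 :: 'a mchar)))"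
    by (subst sum.swap) (simp only: sum_ev_field)
  also have "\<dots> = of_nat CARD('a) - 1"
    by (simp add: of_bool_def if_distrib cong: if_cong)
  finally show ?thesis
    using neq[of x] by (cases "x = 1") simp_all
qed

section \<open>Gauss sums\<close>

lemma sum_of_bool_eq: "(\<Sum>x\<in>UNIV. f x * of_bool (x = a)) = f a"
  for f :: "'b::finite \<Rightarrow> 'c::semiring_1"
  by (simp add: of_bool_def if_distrib cong: if_cong)

text \<open>\<open>Q\<close> is q as a complex number, kept abstract so that algebraic identities
  treat it as an indeterminate.\<close>

locale gauss_sums =
  fixes \<theta> :: "'a::{field,finite} \<Rightarrow> complex" and Q :: complex
  assumes nontrivial: "nontrivial_add_char \<theta>"
    and Q_eq: "Q = of_nat CARD('a)"
begin

lemmas sum_ev_Q = sum_ev_field[where 'a = 'a, folded Q_eq]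

lemmas sum_mchar_Q = sum_ev_mchar[where 'a = 'a, folded Q_eq]

definition G :: "'a mchar \<Rightarrow> complex" where
  "G \<chi> = gauss_sum \<theta> (ev \<chi>)"

definition W :: "'a mchar \<Rightarrow> 'a \<Rightarrow> complex" where
  "W \<chi> c = (\<Sum>x\<in>UNIV. ev \<chi> x * \<theta> (c * x))"

lemma Q_minus_1_neq_0: "Q - 1 \<noteq> 0" and Q_neq_0 [simp]: "Q \<noteq> 0"
  using card_field_gt_1[where 'a = 'a] by (auto simp: Q_eq)

lemma \<theta>_add: "\<theta> (x + y) = \<theta> x * \<theta> y"
  using nontrivial by (simp add: nontrivial_add_char_def add_char_def)

lemma \<theta>_0 [simp]: "\<theta> 0 = 1"
proof -
  have "\<theta> 0 \<noteq> 0"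
    using nontrivial by (simp add: nontrivial_add_char_def add_char_def)
  then show ?thesis
    using \<theta>_add[of 0 0] by simp
qed

lemma sum_\<theta>: "(\<Sum>x\<in>UNIV. \<theta> x) = 0"
proof -
  obtain a where a: "\<theta> a \<noteq> 1"
    using nontrivial by (auto simp: nontrivial_add_char_def)
  have "(\<Sum>x\<in>UNIV. \<theta> (a + x)) = (\<Sum>x\<in>UNIV. \<theta> x)"
    by (rule sum_translate)
  then have "\<theta> a * (\<Sum>x\<in>UNIV. \<theta> x) = (\<Sum>x\<in>UNIV. \<theta> x)"
    by (simp add: \<theta>_add sum_distrib_left)
  with a show ?thesis by simp
qed

lemma G_0 [simp]: "G 0 = - 1"
proof -
  have "G 0 = (\<Sum>x\<in>UNIV. \<theta> x - \<theta> x * of_bool (x = 0))"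
    unfolding G_def gauss_sum_def by (intro sum.cong) auto
  also have "\<dots> = - 1"
    by (simp only: sum_subtractf sum_\<theta> sum_of_bool_eq) simp
  finally show ?thesis .
qed

lemma sum_dilate: "a \<noteq> 0 \<Longrightarrow> (\<Sum>x\<in>UNIV. f (a * x)) = (\<Sum>x\<in>UNIV. f x)"
  for a :: 'a
  by (rule sum.reindex_bij_betw) (rule bij_betw_byWitness[where f' = "\<lambda>y. y / a"]; simp)

text \<open>A dilation by c handles nonzero c. At c = 0 orthogonality leaves a term for trivial
  \<chi> alone, a source of the degenerate contributions below.\<close>

lemma W_eq: "W \<chi> c = ev (- \<chi>) c * G \<chi> + (Q - 1) * of_bool (c = 0 \<and> \<chi> = 0)"
proof (cases "c = 0")
  case True
  then show ?thesis
    by (simp add: W_def sum_ev_Q)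
next
  case False
  have "G \<chi> = (\<Sum>x\<in>UNIV. ev \<chi> (c * x) * \<theta> (c * x))"
    unfolding G_def gauss_sum_def using False by (rule sum_dilate[symmetric])
  also have "\<dots> = ev \<chi> c * W \<chi> c"
    by (simp add: W_def ev_mult sum_distrib_left mult_ac)
  finally show ?thesis
    using False by (simp add: ev_uminus field_simps)
qed

text \<open>Writing the first variable as zt merges the additive characters into \<theta>((1 + t)z).
  At z = 0, where this substitution fails, both summands vanish.\<close>

lemma G_mult_G: "G \<alpha> * G \<gamma> = (\<Sum>t\<in>UNIV. ev \<alpha> t * W (\<alpha> + \<gamma>) (1 + t))"
proof -
  have "G \<alpha> * G \<gamma> = (\<Sum>z\<in>UNIV. G \<alpha> * (ev \<gamma> z * \<theta> z))"
    by (simp add: G_def[of \<gamma>] gauss_sum_def sum_distrib_left)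
  also have "\<dots> = (\<Sum>z\<in>UNIV. \<Sum>t\<in>UNIV. ev \<alpha> t * (ev (\<alpha> + \<gamma>) z * \<theta> ((1 + t) * z)))"
  proof (rule sum.cong)
    fix z
    show "G \<alpha> * (ev \<gamma> z * \<theta> z) = (\<Sum>t\<in>UNIV. ev \<alpha> t * (ev (\<alpha> + \<gamma>) z * \<theta> ((1 + t) * z)))"
    proof (cases "z = 0")
      case False
      then have "G \<alpha> = (\<Sum>t\<in>UNIV. ev \<alpha> (z * t) * \<theta> (z * t))"
        unfolding G_def gauss_sum_def by (rule sum_dilate[symmetric])
      moreover have "\<theta> ((1 + t) * z) = \<theta> z * \<theta> (z * t)" for t
        by (simp add: distrib_right mult.commute[of z] flip: \<theta>_add)
      ultimately show ?thesis
        by (simp add: sum_distrib_left sum_distrib_right ev_mult ev_add mult_ac)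
    qed simp
  qed simp
  also have "\<dots> = (\<Sum>t\<in>UNIV. ev \<alpha> t * W (\<alpha> + \<gamma>) (1 + t))"
    by (subst sum.swap) (simp add: W_def sum_distrib_left)
  finally show ?thesis .
qed

text \<open>With \<open>1 + t\<close> in place of \<open>1 - t\<close>, this is the usual Jacobi sum times \<open>\<alpha>(-1)\<close>.\<close>

definition jacobi :: "'a mchar \<Rightarrow> 'a mchar \<Rightarrow> complex" where
  "jacobi \<alpha> \<beta> = (\<Sum>t\<in>UNIV. ev \<alpha> t * ev \<beta> (1 + t))"

lemma one_plus_eq_0_iff: "1 + t = 0 \<longleftrightarrow> t = - 1" for t :: 'a
  by (metis add.commute add_eq_0_iff)

lemma jacobi_0: "jacobi \<alpha> 0 = (Q - 1) * of_bool (\<alpha> = 0) - ev \<alpha> (- 1)"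
proof -
  have "jacobi \<alpha> 0 = (\<Sum>t\<in>UNIV. ev \<alpha> t - ev \<alpha> t * of_bool (t = - 1))"
    unfolding jacobi_def by (intro sum.cong) (auto simp: one_plus_eq_0_iff)
  then show ?thesis
    by (simp only: sum_subtractf sum_ev_Q sum_of_bool_eq)
qed

text \<open>This is \<open>G_mult_G\<close> with \<open>W_eq\<close> inserted; the correction lives
  at t = -1 and needs \<alpha> + \<gamma> = 0.\<close>

lemma G_mult_G_jacobi:
  "G \<alpha> * G \<gamma> = G (\<alpha> + \<gamma>) * jacobi \<alpha> (- (\<alpha> + \<gamma>)) + (Q - 1) * ev \<alpha> (- 1) * of_bool (\<alpha> + \<gamma> = 0)"
proof -
  have "G \<alpha> * G \<gamma> = (\<Sum>t\<in>UNIV. G (\<alpha> + \<gamma>) * (ev \<alpha> t * ev (- (\<alpha> + \<gamma>)) (1 + t))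
      + (Q - 1) * of_bool (\<alpha> + \<gamma> = 0) * (ev \<alpha> t * of_bool (t = - 1)))"
    unfolding G_mult_G W_eq
    by (intro sum.cong refl) (simp only: one_plus_eq_0_iff of_bool_conj distrib_left mult_ac)
  also have "\<dots> = G (\<alpha> + \<gamma>) * jacobi \<alpha> (- (\<alpha> + \<gamma>)) + (Q - 1) * of_bool (\<alpha> + \<gamma> = 0) * ev \<alpha> (- 1)"
    by (simp only: sum.distrib jacobi_def sum_of_bool_eq flip: sum_distrib_left)
  finally show ?thesis by (simp only: mult_ac)
qed

text \<open>For trivial \<alpha> this reads 1 = Q - (Q - 1), so one formula covers all
  characters.\<close>

lemma G_reflection: "G \<alpha> * G (- \<alpha>) = Q * ev \<alpha> (- 1) - (Q - 1) * of_bool (\<alpha> = 0)"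
  using G_mult_G_jacobi[of \<alpha> "- \<alpha>"] by (simp add: jacobi_0 algebra_simps)

lemma G_reflection_nontrivial: "\<alpha> \<noteq> 0 \<Longrightarrow> G \<alpha> * G (- \<alpha>) = Q * ev \<alpha> (- 1)"
  by (simp add: G_reflection)

lemma G_neq_0 [simp]: "G \<alpha> \<noteq> 0"
proof (cases "\<alpha> = 0")
  case False
  then show ?thesis
    using G_reflection[of \<alpha>] by auto
qed simp

section \<open>Barnes' lemma and Kummer's theorem\<close>

text \<open>
  The character sum forces the four summation variables onto a quadric, which is parametrised
  by pairing the first Gauss sum with the third and the second with the fourth.
\<close>

lemma sum_four_gauss:
  assumes "s \<noteq> 0"
  shows "(\<Sum>\<psi>\<in>UNIV. ev \<psi> s * (G (a + \<psi>) * G (b + \<psi>) * G (c - \<psi>) * G (d - \<psi>))) =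
    (Q - 1) * (\<Sum>t\<in>UNIV. ev a t * ev d (s * t) * (W (a + c) (1 + t) * W (b + d) (1 + s * t)))"
proof -
  define f where "f t u = ev a t * W (a + c) (1 + t) * W (b + d) (1 + u) * ev d u" for t u
  have "ev \<psi> s * (G (a + \<psi>) * G (b + \<psi>) * G (c - \<psi>) * G (d - \<psi>)) =
      (\<Sum>t\<in>UNIV. \<Sum>u\<in>UNIV. f t u * ev \<psi> (s * t / u))" for \<psi>
  proof -
    have "G (a + \<psi>) * G (c - \<psi>) = (\<Sum>t\<in>UNIV. ev (a + \<psi>) t * W (a + c) (1 + t))"
      using G_mult_G[of "a + \<psi>" "c - \<psi>"] by (simp add: algebra_simps)
    \<comment> \<open>With \<open>d - \<psi>\<close> as the first factor, \<psi> enters through 1/u,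
      so the sum over \<psi> tests whether st/u = 1.\<close>
    moreover have "G (d - \<psi>) * G (b + \<psi>) = (\<Sum>u\<in>UNIV. ev (d - \<psi>) u * W (b + d) (1 + u))"
      using G_mult_G[of "d - \<psi>" "b + \<psi>"] by (simp add: algebra_simps)
    moreover have "ev \<psi> s * (G (a + \<psi>) * G (b + \<psi>) * G (c - \<psi>) * G (d - \<psi>)) =
        ev \<psi> s * ((G (a + \<psi>) * G (c - \<psi>)) * (G (d - \<psi>) * G (b + \<psi>)))"
      by (simp only: mult_ac)
    ultimately have "ev \<psi> s * (G (a + \<psi>) * G (b + \<psi>) * G (c - \<psi>) * G (d - \<psi>)) =
        ev \<psi> s * ((\<Sum>t\<in>UNIV. ev (a + \<psi>) t * W (a + c) (1 + t)) *
          (\<Sum>u\<in>UNIV. ev (d - \<psi>) u * W (b + d) (1 + u)))"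
      by (simp only:)
    also have "\<dots> = (\<Sum>t\<in>UNIV. \<Sum>u\<in>UNIV. f t u * ev \<psi> (s * t / u))"
      unfolding sum_product unfolding sum_distrib_left
      by (intro sum.cong refl) (simp add: f_def ev_add ev_diff ev_divide ev_mult)
    finally show ?thesis .
  qed
  then have "(\<Sum>\<psi>\<in>UNIV. ev \<psi> s * (G (a + \<psi>) * G (b + \<psi>) * G (c - \<psi>) * G (d - \<psi>))) =
      (\<Sum>\<psi>\<in>UNIV. \<Sum>t\<in>UNIV. \<Sum>u\<in>UNIV. f t u * ev \<psi> (s * t / u))"
    by simp
  also have "\<dots> = (\<Sum>t\<in>UNIV. \<Sum>u\<in>UNIV. \<Sum>\<psi>\<in>UNIV. f t u * ev \<psi> (s * t / u))"
    by (subst sum.swap) (intro sum.cong refl sum.swap)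
  also have "\<dots> = (\<Sum>t\<in>UNIV. \<Sum>u\<in>UNIV. (Q - 1) * f t u * of_bool (u = s * t))"
  proof (intro sum.cong refl)
    fix t u
    \<comment> \<open>At u = 0 the quotient is 0 by convention, and there \<open>f t u\<close>
      vanishes because \<open>ev d 0 = 0\<close>.\<close>
    have "f t u * of_bool (s * t / u = 1) = f t u * of_bool (u = s * t)"
      by (cases "u = 0") (auto simp: f_def)
    then show "(\<Sum>\<psi>\<in>UNIV. f t u * ev \<psi> (s * t / u)) = (Q - 1) * f t u * of_bool (u = s * t)"
      by (simp only: sum_mchar_Q mult_ac flip: sum_distrib_left)
  qed
  also have "\<dots> = (\<Sum>t\<in>UNIV. (Q - 1) * f t (s * t))"
    by (simp only: sum_of_bool_eq)
  also have "\<dots> = (Q - 1) * (\<Sum>t\<in>UNIV. ev a t * ev d (s * t) * (W (a + c) (1 + t) * W (b + d) (1 + s * t)))"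
    by (simp add: f_def sum_distrib_left mult_ac)
  finally show ?thesis .
qed

text \<open>The analogue of the Mellin-Barnes integral in Barnes' first lemma, with Gauss sums in
  place of Gamma functions.\<close>

definition barnes :: "'a mchar \<Rightarrow> 'a mchar \<Rightarrow> 'a mchar \<Rightarrow> 'a mchar \<Rightarrow> complex" where
  "barnes a b c d = (\<Sum>\<psi>\<in>UNIV. G (a + \<psi>) * G (b + \<psi>) * G (c - \<psi>) * G (d - \<psi>)) / (Q - 1)"

text \<open>At s = 1 both factors \<open>W\<close> in \<open>sum_four_gauss\<close> have the
  argument 1 + t, so their powers combine into one Jacobi sum. At t = -1 only the product of the two
  corrections survives, which needs both pairs to be inverse.\<close>

lemma barnes_jacobi:
  "barnes a b c d = G (a + c) * G (b + d) * jacobi (a + d) (- (a + b + c + d)) +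
    (Q - 1)\<^sup>2 * ev (a + d) (- 1) * of_bool (a + c = 0 \<and> b + d = 0)"
proof -
  have "barnes a b c d = (\<Sum>t\<in>UNIV. ev a t * ev d t * (W (a + c) (1 + t) * W (b + d) (1 + t)))"
    using sum_four_gauss[of 1 a b c d] Q_minus_1_neq_0 by (simp add: barnes_def)
  also have "\<dots> = (\<Sum>t\<in>UNIV.
      G (a + c) * G (b + d) * (ev (a + d) t * ev (- (a + b + c + d)) (1 + t))
      + (Q - 1)\<^sup>2 * of_bool (a + c = 0 \<and> b + d = 0) * (ev (a + d) t * of_bool (t = - 1)))"
  proof (intro sum.cong refl)
    fix t
    show "ev a t * ev d t * (W (a + c) (1 + t) * W (b + d) (1 + t)) =
      G (a + c) * G (b + d) * (ev (a + d) t * ev (- (a + b + c + d)) (1 + t))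
      + (Q - 1)\<^sup>2 * of_bool (a + c = 0 \<and> b + d = 0) * (ev (a + d) t * of_bool (t = - 1))"
    proof (cases "t = - 1")
      case True
      then show ?thesis
        by (simp add: W_eq ev_add power2_eq_square of_bool_conj)
    next
      case False
      then show ?thesis
        by (simp add: W_eq ev_add ev_uminus one_plus_eq_0_iff mult_ac del: minus_add_distrib)
    qed
  qed
  also have "\<dots> = G (a + c) * G (b + d) * jacobi (a + d) (- (a + b + c + d)) +
    (Q - 1)\<^sup>2 * of_bool (a + c = 0 \<and> b + d = 0) * ev (a + d) (- 1)"
    by (simp only: sum.distrib jacobi_def sum_of_bool_eq flip: sum_distrib_left)
  finally show ?thesis by (simp only: mult_ac)
qed

text \<open>If a + b + c + d is nontrivial, the Jacobi sum in \<open>barnes_jacobi\<close> is a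
  quotient of Gauss sums. Otherwise its second character is trivial and everything is explicit
  through reflection.\<close>

lemma barnes_lemma:
  "G (a + c) * G (a + d) * G (b + c) * G (b + d) =
    G (a + b + c + d) * barnes a b c d + Q * (Q - 1) * ev (c + d) (- 1) * of_bool (a + b + c + d = 0)"
proof (cases "a + b + c + d = 0")
  case True
  define x where "x = ev (a + c) (- 1)"
  define y where "y = ev (a + d) (- 1)"
  define u :: complex where "u = of_bool (a + c = 0)"
  define v :: complex where "v = of_bool (a + d = 0)"
  have bd: "b + d = - (a + c)" and bc: "b + c = - (a + d)"
    using True by (simp_all only: eq_neg_iff_add_eq_0 ac_simps)
  \<comment> \<open>The signs a(-1) contained in \<open>x\<close> and \<open>y\<close>
    cancel.\<close>
  have 1: "ev (c + d) (- 1) = x * y"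
    by (simp add: x_def y_def ev_add mult_ac)
  have 2: "barnes a b c d = (Q * x - (Q - 1) * u) * ((Q - 1) * v - y) + (Q - 1)\<^sup>2 * y * u"
    by (simp only: barnes_jacobi True bd G_reflection minus_zero jacobi_0 neg_equal_0_iff_equal
        conj_absorb x_def y_def u_def v_def)
  have 3: "G (a + c) * G (a + d) * G (b + c) * G (b + d) =
      (Q * x - (Q - 1) * u) * (Q * y - (Q - 1) * v)"
    unfolding bd bc x_def y_def u_def v_def by (simp only: mult_ac flip: G_reflection)
  \<comment> \<open>Since \<open>G 0 = - 1\<close>, this is a polynomial identity in
    \<open>Q\<close>, \<open>x\<close>, \<open>y\<close>, \<open>u\<close>,
    \<open>v\<close>.\<close>
  show ?thesis
    unfolding 1 2 3 True by (simp add: algebra_simps power2_eq_square)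
next
  case False
  have "a + d + (b + c) = a + b + c + d"
    by (simp add: ac_simps)
  from G_mult_G_jacobi[of "a + d" "b + c", unfolded this]
  have "G (a + d) * G (b + c) = G (a + b + c + d) * jacobi (a + d) (- (a + b + c + d))"
    using False by (simp del: minus_add_distrib)
  moreover have "\<not> (a + c = 0 \<and> b + d = 0)"
    using False by (metis add.assoc add.left_commute add.right_neutral)
  ultimately show ?thesis
    using False by (simp add: barnes_jacobi mult_ac)
qed

text \<open>
  Since \<open>\<Sum>\<^sub>t (A - 2R)(t)\<close> detects \<open>2R = A\<close>, summing over \<open>R\<close> first leaves the square roots of \<open>u\<close>.
\<close>

lemma sum_square_roots:
  "(\<Sum>t | t * t = u. ev A t) = (\<Sum>R | R + R = A. ev R u)" for u :: 'a
proof -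
  have "(Q - 1) * (\<Sum>R | R + R = A. ev R u) = (\<Sum>R\<in>UNIV. ev R u * ((Q - 1) * of_bool (A - (R + R) = 0)))"
    by (simp add: sum_distrib_left eq_commute[of A] mult_ac of_bool_def if_distrib sum.If_cases cong: if_cong)
  also have "\<dots> = (\<Sum>R\<in>UNIV. \<Sum>t\<in>UNIV. ev A t * ev R (u / (t * t)))"
    by (simp only: sum_distrib_left flip: sum_ev_Q)
       (simp add: ev_diff ev_add ev_divide ev_mult mult_ac)
  also have "\<dots> = (\<Sum>t\<in>UNIV. ev A t * ((Q - 1) * of_bool (u / (t * t) = 1)))"
    by (subst sum.swap) (simp only: sum_mchar_Q flip: sum_distrib_left)
  \<comment> \<open>For nonzero t the two conditions agree; at t = 0 both summands vanish because
    \<open>ev A 0 = 0\<close>.\<close>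
  also have "\<dots> = (\<Sum>t\<in>UNIV. if t * t = u then (Q - 1) * ev A t else 0)"
    by (intro sum.cong refl) (auto simp: divide_eq_eq)
  also have "\<dots> = (Q - 1) * (\<Sum>t | t * t = u. ev A t)"
    by (simp add: sum_distrib_left sum.If_cases)
  finally show ?thesis
    using Q_minus_1_neq_0 by simp
qed

text \<open>This is the substitution u = t^2: grouping t by its square leaves the inner sum of
  \<open>sum_square_roots\<close>.\<close>

lemma sum_comp_square:
  "(\<Sum>t\<in>UNIV. ev A t * f (t * t)) = (\<Sum>R | R + R = A. \<Sum>u\<in>UNIV. ev R u * f u)"
  for f :: "'a \<Rightarrow> complex"
proof -
  have "(\<Sum>t\<in>UNIV. ev A t * f (t * t)) = (\<Sum>u\<in>UNIV. \<Sum>t | t * t = u. ev A t * f (t * t))"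
    using sum.group[of "UNIV :: 'a set" UNIV "\<lambda>t. t * t" "\<lambda>t. ev A t * f (t * t)"] by simp
  also have "\<dots> = (\<Sum>u\<in>UNIV. \<Sum>R | R + R = A. ev R u * f u)"
    by (intro sum.cong refl) (simp flip: sum_distrib_right sum_square_roots)
  finally show ?thesis
    by (subst sum.swap)
qed

text \<open>The case u = 1 of \<open>sum_square_roots\<close>: the right side counts, and the left
  side runs over 1 and -1, which coincide in characteristic two.\<close>

lemma card_square_roots:
  "of_nat (card {R :: 'a mchar. R + R = A}) = (if (1 :: 'a) = - 1 then 1 else 1 + ev A (- 1))"
proof -
  have "{t :: 'a. t * t = 1} = {1, - 1}"
    by (auto simp: square_eq_1_iff)
  moreover have "(\<Sum>t\<in>{1, - 1 :: 'a}. ev A t) = (if (1 :: 'a) = - 1 then 1 else 1 + ev A (- 1))"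
  proof (cases "(1 :: 'a) = - 1")
    case True
    show ?thesis
      unfolding True[symmetric] by simp
  qed simp
  ultimately have "(\<Sum>t | t * t = (1 :: 'a). ev A t) = (if (1 :: 'a) = - 1 then 1 else 1 + ev A (- 1))"
    by (simp only:)
  then show ?thesis
    by (simp add: sum_square_roots)
qed

text \<open>For nontrivial \<psi> the two factors \<open>W\<close> combine to the inverse of \<psi>
  at 1 - t^2, and substituting u = t^2 leaves one Jacobi sum per root R. For trivial \<psi> they are
  explicit, and \<open>card_square_roots\<close> restores the sum over R. In characteristic two 1 +
  t and 1 - t vanish together, whence the last term.\<close>

lemma kummer_sum:
  "(\<Sum>t\<in>UNIV. ev A t * (W \<psi> (1 + t) * W \<psi> (1 - t))) =
    (\<Sum>R | R + R = A. ev R (- 1) * G R * G (\<psi> - R) * G \<psi>) +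
      Q * (Q - 1) * of_bool (\<psi> = 0 \<and> (1 :: 'a) = - 1)"
proof (cases "\<psi> = 0")
  case False
  have "(\<Sum>t\<in>UNIV. ev A t * (W \<psi> (1 + t) * W \<psi> (1 - t))) =
      G \<psi> * G \<psi> * (\<Sum>t\<in>UNIV. ev A t * ev (- \<psi>) (1 - t * t))"
    unfolding sum_distrib_left
  proof (intro sum.cong refl)
    fix t :: 'a
    have "1 - t * t = (1 + t) * (1 - t)"
      by (simp add: algebra_simps)
    then show "ev A t * (W \<psi> (1 + t) * W \<psi> (1 - t)) = G \<psi> * G \<psi> * (ev A t * ev (- \<psi>) (1 - t * t))"
      using False by (simp add: W_eq ev_mult)
  qed
  also have "\<dots> = G \<psi> * (\<Sum>R | R + R = A. G \<psi> * (\<Sum>u\<in>UNIV. ev R u * ev (- \<psi>) (1 - u)))"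
    by (simp only: sum_comp_square[where f = "\<lambda>x. ev (- \<psi>) (1 - x)"] sum_distrib_left mult.assoc)
  also have "\<dots> = G \<psi> * (\<Sum>R | R + R = A. ev R (- 1) * G R * G (\<psi> - R))"
  proof -
    have "G \<psi> * (\<Sum>u\<in>UNIV. ev R u * ev (- \<psi>) (1 - u)) = ev R (- 1) * G R * G (\<psi> - R)" for R
    proof -
      \<comment> \<open>Since \<open>jacobi\<close> is built with 1 + t, the sign of u is switched,
        which produces the factor R(-1).\<close>
      have "(\<Sum>u\<in>UNIV. ev R u * ev (- \<psi>) (1 - u)) =
          (\<Sum>u\<in>UNIV. ev R (- 1 * u) * ev (- \<psi>) (1 - (- 1 * u)))"
        by (rule sum_dilate[symmetric]) simp
      also have "\<dots> = ev R (- 1) * jacobi R (- \<psi>)"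
        unfolding ev_mult[of R "- 1"] by (simp add: jacobi_def sum_distrib_left mult.assoc)
      finally have "(\<Sum>u\<in>UNIV. ev R u * ev (- \<psi>) (1 - u)) = ev R (- 1) * jacobi R (- \<psi>)" .
      moreover have "G R * G (\<psi> - R) = G \<psi> * jacobi R (- \<psi>)"
        using G_mult_G_jacobi[of R "\<psi> - R"] False by simp
      ultimately show ?thesis
        by (simp add: mult_ac)
    qed
    then show ?thesis
      by simp
  qed
  finally show ?thesis
    using False by (simp add: sum_distrib_left mult_ac)
next
  case True
  have W0: "W 0 c = Q * of_bool (c = 0) - 1" for c
    by (simp add: W_eq)
  have "(\<Sum>t\<in>UNIV. ev A t * (W \<psi> (1 + t) * W \<psi> (1 - t))) =
      (\<Sum>t\<in>UNIV. Q\<^sup>2 * of_bool ((1 :: 'a) = - 1) * (ev A t * of_bool (t = 1))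
        - Q * (ev A t * of_bool (t = 1)) - Q * (ev A t * of_bool (t = - 1)) + ev A t)"
  proof (intro sum.cong refl)
    fix t :: 'a
    have "1 - t = 0 \<longleftrightarrow> t = 1"
      by auto
    then show "ev A t * (W \<psi> (1 + t) * W \<psi> (1 - t)) =
        Q\<^sup>2 * of_bool ((1 :: 'a) = - 1) * (ev A t * of_bool (t = 1))
        - Q * (ev A t * of_bool (t = 1)) - Q * (ev A t * of_bool (t = - 1)) + ev A t"
      unfolding True W0 one_plus_eq_0_iff
      by (cases "t = 1"; cases "t = - 1") (auto simp: power2_eq_square algebra_simps)
  qed
  also have "\<dots> = Q\<^sup>2 * of_bool ((1 :: 'a) = - 1) - Q * (1 + ev A (- 1)) + (Q - 1) * of_bool (A = 0)"
    by (simp only: sum.distrib sum_subtractf sum_of_bool_eq sum_ev_Q ev_one flip: sum_distrib_left)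
       (simp add: algebra_simps)
  \<comment> \<open>In characteristic two the root count is 1, and Q^2 - 2Q = -Q + Q(Q - 1).\<close>
  also have "\<dots> = (Q - 1) * of_bool (A = 0) - Q * of_nat (card {R. R + R = A})
      + Q * (Q - 1) * of_bool ((1 :: 'a) = - 1)"
  proof (cases "(1 :: 'a) = - 1")
    case True
    then have "ev A (- 1) = 1"
      by (metis ev_one)
    then show ?thesis
      unfolding card_square_roots \<open>ev A (- 1) = 1\<close> using True by (simp add: algebra_simps power2_eq_square)
  qed (simp add: card_square_roots algebra_simps)
  also have "(Q - 1) * of_bool (A = 0) - Q * of_nat (card {R. R + R = A}) =
      (\<Sum>R | R + R = A. ev R (- 1) * G R * G (0 - R) * G 0)"
  proof -
    have "(\<Sum>R | R + R = A. ev R (- 1) * G R * G (0 - R) * G 0) =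
        (\<Sum>R | R + R = A. (Q - 1) * of_bool (R = 0) - Q)"
      by (intro sum.cong refl) (simp add: G_reflection mult.assoc right_diff_distrib)
    also have "\<dots> = (Q - 1) * (\<Sum>R | R + R = A. of_bool (R = 0)) - Q * of_nat (card {R. R + R = A})"
      by (simp add: sum_subtractf sum_distrib_left)
    also have "(\<Sum>R | R + R = A. of_bool (R = 0)) = (of_bool (A = 0) :: complex)"
      by (cases "A = 0") (auto simp: of_bool_def)
    finally show ?thesis by simp
  qed
  finally show ?thesis
    using True by simp
qed

text \<open>In \<open>sum_four_gauss\<close> take s = -1 and d = 0: both pairs of characters then
  add up to \<psi>, and the arguments of \<open>W\<close> become 1 + t and 1 - t.\<close>

lemma kummer_theorem:
  "(\<Sum>\<chi>\<in>UNIV. ev \<chi> (- 1) * (G (A + \<chi>) * G (\<psi> + \<chi>) * G (\<psi> - A - \<chi>) * G (- \<chi>))) =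
    (Q - 1) * ((\<Sum>R | R + R = A. ev R (- 1) * G R * G (\<psi> - R) * G \<psi>) +
      Q * (Q - 1) * of_bool (\<psi> = 0 \<and> (1 :: 'a) = - 1))"
proof -
  have "(\<Sum>t\<in>UNIV. ev A t * ev 0 (- t) * (W \<psi> (1 + t) * W \<psi> (1 - t))) =
      (\<Sum>t\<in>UNIV. ev A t * (W \<psi> (1 + t) * W \<psi> (1 - t)))"
    by (intro sum.cong) auto
  then show ?thesis
    using sum_four_gauss[of "- 1" A \<psi> "\<psi> - A" 0] by (simp add: kummer_sum)
qed

section \<open>The well-poised sum\<close>

text \<open>Needed for the correction term of Barnes' lemma. The sum over \<chi> forces t = -1,
  where \<open>W A 0\<close> is nonzero only for trivial A.\<close>

lemma sum_gauss_pair: "(\<Sum>\<chi>\<in>UNIV. ev \<chi> (- 1) * (G (A + \<chi>) * G (- \<chi>))) = (Q - 1)\<^sup>2 * of_bool (A = 0)"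
proof -
  have "ev \<chi> (- 1) * (G (A + \<chi>) * G (- \<chi>)) = (\<Sum>t\<in>UNIV. ev A t * W A (1 + t) * ev \<chi> (- t))" for \<chi>
  proof -
    have "ev \<chi> (- 1) * (G (A + \<chi>) * G (- \<chi>)) = (\<Sum>t\<in>UNIV. ev \<chi> (- 1) * (ev (A + \<chi>) t * W A (1 + t)))"
      by (simp add: G_mult_G sum_distrib_left)
    also have "\<dots> = (\<Sum>t\<in>UNIV. ev A t * W A (1 + t) * ev \<chi> (- t))"
    proof (intro sum.cong refl)
      fix t :: 'a
      show "ev \<chi> (- 1) * (ev (A + \<chi>) t * W A (1 + t)) = ev A t * W A (1 + t) * ev \<chi> (- t)"
        using ev_mult[of \<chi> "- 1" t] by (simp add: ev_add)
    qed
    finally show ?thesis .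
  qed
  then have "(\<Sum>\<chi>\<in>UNIV. ev \<chi> (- 1) * (G (A + \<chi>) * G (- \<chi>))) =
      (\<Sum>t\<in>UNIV. \<Sum>\<chi>\<in>UNIV. ev A t * W A (1 + t) * ev \<chi> (- t))"
    by (simp add: sum.swap[of _ UNIV "UNIV :: 'a set"])
  also have "\<dots> = (\<Sum>t\<in>UNIV. (Q - 1) * (ev A t * W A (1 + t)) * of_bool (t = - 1))"
  proof (intro sum.cong refl)
    fix t :: 'a
    have "- t = 1 \<longleftrightarrow> t = - 1"
      by (metis minus_minus)
    then show "(\<Sum>\<chi>\<in>UNIV. ev A t * W A (1 + t) * ev \<chi> (- t)) =
        (Q - 1) * (ev A t * W A (1 + t)) * of_bool (t = - 1)"
      unfolding sum_distrib_left[symmetric] sum_mchar_Q by (simp only: mult_ac)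
  qed
  also have "\<dots> = (Q - 1)\<^sup>2 * of_bool (A = 0)"
    by (simp only: sum_of_bool_eq) (auto simp: W_eq power2_eq_square)
  finally show ?thesis .
qed

text \<open>
  Barnes' lemma expands four of the six Gauss sums; the sum over \<open>\<chi>\<close> becomes Kummer's,
  and the remaining sum over \<open>\<psi>\<close> is again one of Barnes' sums.
\<close>

lemma sum_well_poised:
  "(\<Sum>\<chi>\<in>UNIV. G (A + \<chi>) * G (B + \<chi>) * G (C + \<chi>) * G (B - A - \<chi>) * G (C - A - \<chi>) * G (- \<chi>) * ev \<chi> (- 1)) =
    (Q - 1) * (G (B + C - A) * (\<Sum>R | R + R = A. ev R (- 1) * G R * barnes (- R) 0 B C)
      + Q * G (B + C - A) * G B * G C * of_bool ((1 :: 'a) = - 1)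
      + Q * (Q - 1)\<^sup>2 * of_bool (A = 0 \<and> B + C = 0))"
proof -
  define K where "K \<psi> \<chi> = ev \<chi> (- 1) * (G (A + \<chi>) * G (\<psi> + \<chi>) * G (\<psi> - A - \<chi>) * G (- \<chi>))" for \<psi> \<chi>
  define e where "e = Q * (Q - 1) * ev (B + C) (- 1) * of_bool (B + C - A = 0)"
  have "G (A + \<chi>) * G (B + \<chi>) * G (C + \<chi>) * G (B - A - \<chi>) * G (C - A - \<chi>) * G (- \<chi>) * ev \<chi> (- 1) =
      G (B + C - A) / (Q - 1) * (\<Sum>\<psi>\<in>UNIV. G (B - \<psi>) * G (C - \<psi>) * K \<psi> \<chi>)
      + e * (ev \<chi> (- 1) * (G (A + \<chi>) * G (- \<chi>)))" (is "?l = _") for \<chi>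
  proof -
    \<comment> \<open>Barnes' lemma is used with first pair \<open>\<chi>\<close>,
      \<open>- A - \<chi>\<close>. Its sum is free of \<chi>, so the prefactor
      \<open>G (B + C - A)\<close> and the correction \<open>e\<close> are constants.\<close>
    have "?l = G (\<chi> + B) * G (\<chi> + C) * G (- A - \<chi> + B) * G (- A - \<chi> + C) * (ev \<chi> (- 1) * (G (A + \<chi>) * G (- \<chi>)))"
      by (simp add: algebra_simps)
    also have "\<dots> = (G (B + C - A) * barnes \<chi> (- A - \<chi>) B C + e) * (ev \<chi> (- 1) * (G (A + \<chi>) * G (- \<chi>)))"
      unfolding barnes_lemma by (simp add: e_def algebra_simps)
    also have "\<dots> = G (B + C - A) / (Q - 1) * (\<Sum>\<psi>\<in>UNIV. G (B - \<psi>) * G (C - \<psi>) * K \<psi> \<chi>)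
      + e * (ev \<chi> (- 1) * (G (A + \<chi>) * G (- \<chi>)))"
    proof -
      have "barnes \<chi> (- A - \<chi>) B C * (ev \<chi> (- 1) * (G (A + \<chi>) * G (- \<chi>))) =
          (\<Sum>\<psi>\<in>UNIV. G (B - \<psi>) * G (C - \<psi>) * K \<psi> \<chi>) / (Q - 1)"
        unfolding barnes_def K_def times_divide_eq_left sum_distrib_right
        by (intro arg_cong2[where f = "(/)"] sum.cong refl) (simp add: algebra_simps)
      then show ?thesis
        by (simp add: distrib_right mult.assoc)
    qed
    finally show ?thesis .
  qed
  then have "(\<Sum>\<chi>\<in>UNIV. G (A + \<chi>) * G (B + \<chi>) * G (C + \<chi>) * G (B - A - \<chi>) * G (C - A - \<chi>) * G (- \<chi>) * ev \<chi> (- 1)) =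
      G (B + C - A) / (Q - 1) * (\<Sum>\<chi>\<in>UNIV. \<Sum>\<psi>\<in>UNIV. G (B - \<psi>) * G (C - \<psi>) * K \<psi> \<chi>)
      + e * ((Q - 1)\<^sup>2 * of_bool (A = 0))"
    by (simp only: sum.distrib sum_gauss_pair flip: sum_distrib_left)
  also have "(\<Sum>\<chi>\<in>UNIV. \<Sum>\<psi>\<in>UNIV. G (B - \<psi>) * G (C - \<psi>) * K \<psi> \<chi>) =
      (\<Sum>\<psi>\<in>UNIV. G (B - \<psi>) * G (C - \<psi>) * ((Q - 1) * ((\<Sum>R | R + R = A. ev R (- 1) * G R * G (\<psi> - R) * G \<psi>) +
      Q * (Q - 1) * of_bool (\<psi> = 0 \<and> (1 :: 'a) = - 1))))"
    by (subst sum.swap) (simp only: K_def kummer_theorem flip: sum_distrib_left)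
  \<comment> \<open>For fixed R the factors depending on \<psi> form Barnes' sum with parameters
    \<open>- R\<close>, \<open>0\<close>, \<open>B\<close>, \<open>C\<close>; the term of
    characteristic two keeps only trivial \<psi>.\<close>
  also have "\<dots> = (Q - 1) * ((\<Sum>\<psi>\<in>UNIV. \<Sum>R | R + R = A. ev R (- 1) * G R * (G (- R + \<psi>) * G (0 + \<psi>) * G (B - \<psi>) * G (C - \<psi>)))
      + (\<Sum>\<psi>\<in>UNIV. Q * (Q - 1) * of_bool ((1 :: 'a) = - 1) * (G (B - \<psi>) * G (C - \<psi>)) * of_bool (\<psi> = 0)))"
    unfolding sum_distrib_left sum.distrib[symmetric]
    by (intro sum.cong refl) (simp add: sum_distrib_left algebra_simps of_bool_conj)
  also have "(\<Sum>\<psi>\<in>UNIV. \<Sum>R | R + R = A. ev R (- 1) * G R * (G (- R + \<psi>) * G (0 + \<psi>) * G (B - \<psi>) * G (C - \<psi>))) =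
      (Q - 1) * (\<Sum>R | R + R = A. ev R (- 1) * G R * barnes (- R) 0 B C)"
  proof -
    have "(\<Sum>\<psi>\<in>UNIV. ev R (- 1) * G R * (G (- R + \<psi>) * G (0 + \<psi>) * G (B - \<psi>) * G (C - \<psi>))) =
        (Q - 1) * (ev R (- 1) * G R * barnes (- R) 0 B C)" for R
      using Q_minus_1_neq_0 unfolding barnes_def sum_distrib_left[symmetric] by simp
    then show ?thesis
      by (subst sum.swap) (simp only: sum_distrib_left)
  qed
  also have "(\<Sum>\<psi>\<in>UNIV. Q * (Q - 1) * of_bool ((1 :: 'a) = - 1) * (G (B - \<psi>) * G (C - \<psi>)) * of_bool (\<psi> = 0)) =
      Q * (Q - 1) * of_bool ((1 :: 'a) = - 1) * (G B * G C)"
    by (simp only: sum_of_bool_eq diff_zero)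
  also have "e * ((Q - 1)\<^sup>2 * of_bool (A = 0)) = (Q - 1) * (Q * (Q - 1)\<^sup>2 * of_bool (A = 0 \<and> B + C = 0))"
    by (auto simp: e_def)
  also have "G (B + C - A) / (Q - 1) * ((Q - 1) * ((Q - 1) * (\<Sum>R | R + R = A. ev R (- 1) * G R * barnes (- R) 0 B C)
        + Q * (Q - 1) * of_bool ((1 :: 'a) = - 1) * (G B * G C)))
      + (Q - 1) * (Q * (Q - 1)\<^sup>2 * of_bool (A = 0 \<and> B + C = 0)) =
    (Q - 1) * (G (B + C - A) * (\<Sum>R | R + R = A. ev R (- 1) * G R * barnes (- R) 0 B C)
      + Q * G (B + C - A) * G B * G C * of_bool ((1 :: 'a) = - 1)
      + Q * (Q - 1)\<^sup>2 * of_bool (A = 0 \<and> B + C = 0))"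
  proof -
    have "g / r * (r * (r * s + Q * r * b * (x * y))) + r * z = r * (g * s + Q * g * x * y * b + z)"
      if "r \<noteq> 0" for r g s b x y z :: complex
      using that by (simp add: algebra_simps)
    from this[OF Q_minus_1_neq_0] show ?thesis .
  qed
  finally show ?thesis .
qed

section \<open>Reduction of the hypergeometric value to Barnes sums\<close>

definition well_poised :: "'a mchar \<Rightarrow> 'a mchar \<Rightarrow> 'a mchar \<Rightarrow> complex" where
  "well_poised A B C = hyp_3F2_star \<theta> (ev A) (ev B) (ev C) (ev (A - B)) (ev (A - C)) 1"

text \<open>The normalising denominators of the series; \<open>G (B - A)\<close> and
  \<open>G (C - A)\<close> come from the inverses of the lower parameters.\<close>

abbreviation D :: "'a mchar \<Rightarrow> 'a mchar \<Rightarrow> 'a mchar \<Rightarrow> complex" where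
  "D A B C \<equiv> G A * G B * G C * G (B - A) * G (C - A)"

lemma well_poised_commute: "well_poised A B C = well_poised A C B"
  unfolding well_poised_def hyp_3F2_star_def by (simp add: mult_ac)

lemma well_poised_eq:
  "well_poised A B C = (G (B + C - A) * (\<Sum>R | R + R = A. ev R (- 1) * G R * barnes (- R) 0 B C)
      + Q * G (B + C - A) * G B * G C * of_bool ((1 :: 'a) = - 1)
      + Q * (Q - 1)\<^sup>2 * of_bool (A = 0 \<and> B + C = 0)) / D A B C"
proof -
  have mult: "gauss_sum \<theta> (ev \<alpha> \<cdot>\<^sub>c ev \<chi>) = G (\<alpha> + \<chi>)" for \<alpha> \<chi>
    by (simp add: G_def plus_mchar.rep_eq)
  have inv: "gauss_sum \<theta> (char_inv (ev \<alpha>)) = G (- \<alpha>)" for \<alpha>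
    by (simp add: G_def uminus_mchar.rep_eq)
  have mult_inv: "gauss_sum \<theta> (char_inv (ev (A - \<alpha>) \<cdot>\<^sub>c ev \<chi>)) = G (\<alpha> - A - \<chi>)" for \<alpha> \<chi>
    using inv[of "A - \<alpha> + \<chi>"] by (simp add: plus_mchar.rep_eq)
  have "well_poised A B C = 1 / (Q - 1) * (\<Sum>\<chi>\<in>UNIV.
      (G (A + \<chi>) / G A) * (G (B + \<chi>) / G B) * (G (C + \<chi>) / G C) *
      (G (B - A - \<chi>) / G (B - A)) * (G (C - A - \<chi>) / G (C - A)) * G (- \<chi>) * ev \<chi> (- 1) * ev \<chi> 1)"
    unfolding well_poised_def hyp_3F2_star_def sum_mult_char Q_eq mult mult_inv inv
    by (simp add: G_def)
  also have "\<dots> = (\<Sum>\<chi>\<in>UNIV. G (A + \<chi>) * G (B + \<chi>) * G (C + \<chi>) *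
      G (B - A - \<chi>) * G (C - A - \<chi>) * G (- \<chi>) * ev \<chi> (- 1)) / (Q - 1) / D A B C"
    by (simp add: sum_divide_distrib mult_ac)
  finally show ?thesis
    using Q_minus_1_neq_0 by (simp add: sum_well_poised)
qed

lemma barnes_neq:
  assumes "R \<noteq> B + C"
  shows "barnes (- R) 0 B C = G (B - R) * G (C - R) * G B * G C / G (B + C - R)"
proof -
  have "- R + 0 + B + C = B + C - R" "B + C - R \<noteq> 0"
    using assms by (auto simp: algebra_simps)
  \<comment> \<open>The variables of \<open>barnes_lemma\<close> first occur in the order
    \<open>a\<close>, \<open>c\<close>, \<open>d\<close>, \<open>b\<close>, so this is its case b =
    0.\<close>
  then show ?thesis
    using barnes_lemma[of "- R" B C 0] by (simp add: field_simps)
qed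

text \<open>The exceptional root R = B + C: the four parameters add up to 0, so
  \<open>G 0 = - 1\<close> and the correction of Barnes' lemma enter.\<close>

lemma barnes_sum:
  "barnes (- (B + C)) 0 B C = Q * (Q - 1) * ev (B + C) (- 1) - G (- B) * G (- C) * G B * G C"
  using barnes_lemma[of "- (B + C)" B C 0] by (simp add: algebra_simps)

text \<open>Reflection turns the denominator of \<open>barnes_neq\<close> into a numerator. If B and
  C are nontrivial, the exceptional root obeys the same formula, with \<open>G 0 = - 1\<close>
  supplying the sign.\<close>

lemma Q_times_barnes:
  assumes "R \<noteq> B + C \<or> B \<noteq> 0 \<and> C \<noteq> 0"
  shows "Q * barnes (- R) 0 B C =
    ev (R + B + C) (- 1) * G (B - R) * G (C - R) * G B * G C * G (R - (B + C))"
proof (cases "R = B + C")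
  case False
  then have "G (B + C - R) * G (R - (B + C)) = Q * ev (R + B + C) (- 1)"
    using G_reflection[of "B + C - R"] by (simp add: ev_diff ev_add divide_inverse mult_ac)
  then have "ev (R + B + C) (- 1) * (G (B + C - R) * G (R - (B + C))) = Q"
    by (simp only: mult.left_commute ev_minus_one_squared mult_1_right)
  then have "Q / G (B + C - R) = ev (R + B + C) (- 1) * G (R - (B + C))"
    by (simp add: divide_eq_eq mult_ac)
  moreover have "Q * barnes (- R) 0 B C = Q / G (B + C - R) * (G (B - R) * G (C - R) * G B * G C)"
    using False by (simp add: barnes_neq)
  ultimately show ?thesis
    by (simp only: mult_ac)
next
  case True
  with assms have "B \<noteq> 0" "C \<noteq> 0"
    by auto
  then have "G B * G (- B) = Q * ev B (- 1)" "G C * G (- C) = Q * ev C (- 1)"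
    by (simp_all add: G_reflection)
  then have "G (- B) * G (- C) * G B * G C = Q * Q * ev (B + C) (- 1)"
  proof -
    have "G (- B) * G (- C) * G B * G C = (G B * G (- B)) * (G C * G (- C))"
      by (simp only: mult_ac)
    also have "\<dots> = Q * Q * ev (B + C) (- 1)"
      unfolding \<open>G B * G (- B) = _\<close> \<open>G C * G (- C) = _\<close> ev_add by (simp only: mult_ac)
    finally show ?thesis .
  qed
  then have "Q * barnes (- (B + C)) 0 B C = - (G (- C) * G (- B) * G B * G C)"
    unfolding barnes_sum by (simp add: algebra_simps)
  moreover have "B - (B + C) = - C" "C - (B + C) = - B" "ev (B + C + B + C) (- 1) = 1"
    by (simp_all add: ev_add mult_ac)
  ultimately show ?thesis
    unfolding True by simp
qed

section \<open>Square roots in the character group\<close>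

lemma square_roots_char_2:
  assumes "(1 :: 'a) = - 1" "R\<^sub>0 + R\<^sub>0 = A"
  shows "{R :: 'a mchar. R + R = A} = {R\<^sub>0}"
proof -
  have "of_nat (card {R :: 'a mchar. R + R = A}) = (of_nat 1 :: complex)"
    using assms(1) by (simp add: card_square_roots)
  then have "card {R :: 'a mchar. R + R = A} = 1"
    by (simp only: of_nat_eq_iff)
  then obtain R where "{R :: 'a mchar. R + R = A} = {R}"
    by (auto simp: card_1_singleton_iff)
  moreover have "R\<^sub>0 \<in> {R. R + R = A}"
    using assms(2) by simp
  ultimately show ?thesis
    by simp
qed

lemma square_roots_order_two:
  assumes "\<phi> \<noteq> 0" "\<phi> + \<phi> = 0" "R\<^sub>0 + R\<^sub>0 = A"
  shows "(1 :: 'a) \<noteq> - 1" "{R :: 'a mchar. R + R = A} = {R\<^sub>0, R\<^sub>0 + \<phi>}"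
proof -
  \<comment> \<open>In characteristic two the trivial character would be its own only square root,
    but \<phi> is another.\<close>
  show odd: "(1 :: 'a) \<noteq> - 1"
    using square_roots_char_2[of 0 0] assms by auto
  have "ev A (- 1) = 1"
    using assms(3) by (auto simp: ev_add)
  then have "of_nat (card {R :: 'a mchar. R + R = A}) = (of_nat 2 :: complex)"
    unfolding card_square_roots using odd by simp
  then have "card {R :: 'a mchar. R + R = A} = 2"
    by (simp only: of_nat_eq_iff)
  moreover have "card {R\<^sub>0, R\<^sub>0 + \<phi>} = 2"
    using assms by simp
  moreover have "R\<^sub>0 + \<phi> + (R\<^sub>0 + \<phi>) = A"
    using assms by (metis add.assoc add.left_commute add.right_neutral)
  ultimately show "{R :: 'a mchar. R + R = A} = {R\<^sub>0, R\<^sub>0 + \<phi>}"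
    using assms by (intro card_subset_eq[symmetric]) auto
qed

lemma order_two_exists:
  assumes "(1 :: 'a) \<noteq> - 1"
  obtains \<phi> :: "'a mchar" where "\<phi> \<noteq> 0" "\<phi> + \<phi> = 0"
proof -
  have "of_nat (card {R :: 'a mchar. R + R = 0}) = (of_nat 2 :: complex)"
    unfolding card_square_roots using assms by simp
  then have "card {R :: 'a mchar. R + R = 0} = 2"
    by (simp only: of_nat_eq_iff)
  then obtain x y :: "'a mchar" where "x \<noteq> y" "{R. R + R = 0} = {x, y}"
    by (auto simp: card_2_iff)
  then show ?thesis
    using that[of x] that[of y] by (cases "x = 0") auto
qed

section \<open>Evaluation of the individual cases\<close>

lemma well_poised_nonsquare:
  assumes "\<nexists>R. R + R = A"
  shows "well_poised A B C = 0"
proof -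
  have "(of_nat (card {R. R + R = A}) :: complex) = 0"
    using assms by simp
  \<comment> \<open>In characteristic two every character has a square root, so the second term of
    \<open>well_poised_eq\<close> drops out.\<close>
  then have "(1 :: 'a) \<noteq> - 1"
    unfolding card_square_roots by (metis zero_neq_one)
  moreover have "A \<noteq> 0"
    using assms by (metis add_0_left)
  ultimately show ?thesis
    using assms unfolding well_poised_eq by simp
qed

text \<open>The first two hypotheses leave only the sum over R in \<open>well_poised_eq\<close>. The
  third makes \<open>Q_times_barnes\<close> applicable to every root, because R = B + C would force
  (B + C) + (B + C) = A.\<close>

lemma well_poised_generic:
  assumes "(1 :: 'a) \<noteq> - 1" "\<not> (A = 0 \<and> B + C = 0)"
    and "(B + C) + (B + C) \<noteq> A \<or> B \<noteq> 0 \<and> C \<noteq> 0"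
  shows "well_poised A B C = (\<Sum>R | R + R = A.
    (G (B + C - A) * G (B - R) * G (C - R) * G R * G (R - (B + C))) /
    (G (B - A) * G (C - A) * G A * ev (B + C) (- 1) * Q))"
proof -
  have "well_poised A B C = (\<Sum>R | R + R = A. G (B + C - A) * (ev R (- 1) * G R * barnes (- R) 0 B C) / D A B C)"
  proof -
    have "of_bool ((1 :: 'a) = - 1) = (0 :: complex)" "of_bool (A = 0 \<and> B + C = 0) = (0 :: complex)"
      using assms(1,2) by (simp_all only: of_bool_eq_0_iff not_False_eq_True)
    then show ?thesis
      unfolding well_poised_eq by (simp only:) (simp add: sum_distrib_left sum_divide_distrib)
  qed
  also have "\<dots> = (\<Sum>R | R + R = A.
    (G (B + C - A) * G (B - R) * G (C - R) * G R * G (R - (B + C))) /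
    (G (B - A) * G (C - A) * G A * ev (B + C) (- 1) * Q))"
  proof (intro sum.cong refl)
    fix R assume "R \<in> {R. R + R = A}"
    with assms(3) have "R \<noteq> B + C \<or> B \<noteq> 0 \<and> C \<noteq> 0"
      by auto
    then have "barnes (- R) 0 B C =
        ev (R + B + C) (- 1) * G (B - R) * G (C - R) * G B * G C * G (R - (B + C)) / Q"
      using Q_times_barnes by (simp add: field_simps)
    \<comment> \<open>The sign R(-1) from Kummer's theorem cancels the one in Barnes' sum; the sign
      left over is its own inverse and may stand in the denominator.\<close>
    then show "G (B + C - A) * (ev R (- 1) * G R * barnes (- R) 0 B C) / D A B C =
        (G (B + C - A) * G (B - R) * G (C - R) * G R * G (R - (B + C))) /
        (G (B - A) * G (C - A) * G A * ev (B + C) (- 1) * Q)"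
      by (simp add: ev_add divide_inverse mult_ac) (simp add: field_simps)
  qed
  finally show ?thesis .
qed

text \<open>
  Here \<open>R = B + C\<close> is one square root of \<open>A\<close>. The other one exists only in odd characteristic,
  but then contributes as much as the extra term does in characteristic two.
\<close>

lemma well_poised_double_sum:
  assumes A: "A = (B + C) + (B + C)" and BC: "B = 0 \<or> B + C = 0"
    and C: "C = 0 \<or> C + C \<noteq> 0"
  shows "well_poised A B C = (G (- (B + C)) * (ev (B + C) (- 1) * G (B + C) *
      (Q * (Q - 1) * ev (B + C) (- 1) - G (- B) * G (- C) * G B * G C))
      + Q * ev B (- 1) * G (- (B + C)) * G B * G C
      + Q * (Q - 1)\<^sup>2 * of_bool (A = 0 \<and> B + C = 0)) / D A B C"
proof -
  have BCA: "B + C - A = - (B + C)"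
    by (simp add: A)
  show ?thesis
  proof (cases "(1 :: 'a) = - 1")
    case True
    then have ev_B: "ev B (- 1) = 1"
      by (metis ev_one)
    have roots: "{R. R + R = A} = {B + C}"
      using True A by (intro square_roots_char_2) auto
    show ?thesis
      unfolding well_poised_eq BCA ev_B roots using True
      by (simp add: barnes_sum del: minus_add_distrib)
  next
    case False
    then obtain \<phi> :: "'a mchar" where \<phi>: "\<phi> \<noteq> 0" "\<phi> + \<phi> = 0"
      by (rule order_two_exists)
    have roots: "{R. R + R = A} = {B + C, B + C + \<phi>}"
      using \<phi> A by (intro square_roots_order_two) auto
    have neg: "- \<phi> = \<phi>"
      using \<phi>(2) by (simp add: neg_eq_iff_add_eq_0)
    \<comment> \<open>Otherwise C = \<phi>, which is nontrivial with C + C = 0, against the third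
      hypothesis.\<close>
    have "C + \<phi> \<noteq> 0"
      using \<phi> C by (metis add_eq_0_iff2 add.inverse_inverse add_0_left)
    then have "G (C + \<phi>) * G (- C + \<phi>) = Q * ev (C + \<phi>) (- 1)"
      using G_reflection_nontrivial[of "C + \<phi>"] by (simp add: neg)
    then have refl: "ev (C + \<phi>) (- 1) * (G (C + \<phi>) * G (- C + \<phi>)) = Q"
      by (simp only: mult.left_commute ev_minus_one_squared mult_1_right)
    have "barnes (- (B + C + \<phi>)) 0 B C = G (- C + \<phi>) * G (- B + \<phi>) * G B * G C / G \<phi>"
      using \<phi> barnes_neq[of "B + C + \<phi>" B C] by (simp add: neg)
    \<comment> \<open>Two of the three Gauss sums are a reflection pair and the third is
      \<open>G \<phi>\<close>; which ones pair up depends on whether B or B + C is trivial.\<close>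
    moreover have "ev (B + C + \<phi>) (- 1) * G (B + C + \<phi>) * (G (- C + \<phi>) * G (- B + \<phi>)) = Q * ev B (- 1) * G \<phi>"
      using BC
    proof
      assume "B = 0"
      with refl show ?thesis
        by (simp add: mult_ac)
    next
      assume *: "B + C = 0"
      then have B: "- B = C"
        by (simp add: neg_eq_iff_add_eq_0)
      then have "ev (C + \<phi>) (- 1) = ev B (- 1) * ev \<phi> (- 1)"
        using ev_uminus[of B "- 1"] by (simp add: ev_add)
      with refl have "ev B (- 1) * Q = ev B (- 1) * (ev B (- 1) * ev \<phi> (- 1) * (G (C + \<phi>) * G (- C + \<phi>)))"
        by (simp only:)
      then have "ev B (- 1) * Q = ev \<phi> (- 1) * (G (C + \<phi>) * G (- C + \<phi>))"
        by (simp only: mult.assoc ev_minus_one_squared_left)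
      then show ?thesis
        unfolding * B by (simp add: mult_ac)
    qed
    moreover have "e * g * (x * y * b * c / f) = Q * h * b * c"
      if "e * g * (x * y) = Q * h * f" "f \<noteq> 0" for e g x y b c f h
      using that by (simp add: divide_eq_eq) (simp add: mult_ac)
    ultimately have "ev (B + C + \<phi>) (- 1) * G (B + C + \<phi>) * barnes (- (B + C + \<phi>)) 0 B C =
        Q * ev B (- 1) * G B * G C"
      by (simp only: G_neq_0 not_False_eq_True)
    then show ?thesis
      unfolding well_poised_eq BCA roots using False \<phi>
      by (simp add: barnes_sum distrib_left mult.assoc del: minus_add_distrib)
  qed
qed

text \<open>The Gauss sums of C and of C + C pair off by reflection. Modulo these relations the
  numerator is 3 - Q times the denominator, an ideal membership left to
  \<open>algebra\<close>.\<close>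

lemma well_poised_zero_double:
  assumes "C + C \<noteq> 0"
  shows "well_poised (C + C) 0 C = - Q + 3"
proof -
  have "C \<noteq> 0"
    using assms by auto
  then have "G C * G (- C) = Q * ev C (- 1)"
    by (simp add: G_reflection)
  moreover have "G (C + C) * G (- (C + C)) = Q"
    using G_reflection[of "C + C"] assms by (simp add: ev_add)
  moreover have "ev C (- 1) * ev C (- 1) = 1"
    by simp
  moreover have "y * (c * x * (Q * (Q - 1) * c - y * x)) - Q * y * x = (- Q + 3) * (- (z * x * w * y))"
    if "x * y = Q * c" "z * w = Q" "c * c = 1" for x y z w c
    using that by Groebner_Basis.algebra
  ultimately have "G (- C) * (ev C (- 1) * G C * (Q * (Q - 1) * ev C (- 1) - G (- C) * G C)) - Q * G (- C) * G C
      = (- Q + 3) * (- (G (C + C) * G C * G (- (C + C)) * G (- C)))"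
    by blast
  moreover have "well_poised (C + C) 0 C =
      (G (- C) * (ev C (- 1) * G C * (Q * (Q - 1) * ev C (- 1) - G (- C) * G C)) - Q * G (- C) * G C)
      / (- (G (C + C) * G C * G (- (C + C)) * G (- C)))"
    using assms well_poised_double_sum[of "C + C" 0 C] by simp
  ultimately show ?thesis
    by (simp only: nonzero_mult_div_cancel_right neg_equal_0_iff_equal mult_eq_0_iff G_neq_0 disj_absorb
        not_False_eq_True)
qed

text \<open>Same method as \<open>well_poised_zero_double\<close>, now with B + C = 0 and hence with
  the last term of \<open>well_poised_double_sum\<close> present.\<close>

lemma well_poised_trivial_inverse:
  assumes "B + B \<noteq> 0"
  shows "well_poised 0 B (- B) = - Q + 3"
proof -
  have "B \<noteq> 0"
    using assms by auto
  then have "G B * G (- B) = Q * ev B (- 1)"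
    by (simp add: G_reflection)
  moreover have "ev B (- 1) * ev B (- 1) = 1"
    by simp
  moreover have "Q * (Q - 1) - y * x * x * y - Q * c * x * y + Q * (Q - 1)\<^sup>2 = (- Q + 3) * (- (x * y * x * y))"
    if "x * y = Q * c" "c * c = 1" for x y c
    using that by Groebner_Basis.algebra
  ultimately have "Q * (Q - 1) - G (- B) * G B * G B * G (- B) - Q * ev B (- 1) * G B * G (- B) + Q * (Q - 1)\<^sup>2 =
      (- Q + 3) * (- (G B * G (- B) * G B * G (- B)))"
    by blast
  moreover have "- B + - B \<noteq> 0"
    using assms unfolding minus_add_distrib[symmetric] by (simp only: neg_equal_0_iff_equal not_False_eq_True)
  then have "well_poised 0 B (- B) =
      (Q * (Q - 1) - G (- B) * G B * G B * G (- B) - Q * ev B (- 1) * G B * G (- B) + Q * (Q - 1)\<^sup>2)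
      / (- (G B * G (- B) * G B * G (- B)))"
    using well_poised_double_sum[of 0 B "- B"] by (simp add: mult_ac)
  ultimately show ?thesis
    by (simp only: nonzero_mult_div_cancel_right neg_equal_0_iff_equal mult_eq_0_iff G_neq_0 disj_absorb
        not_False_eq_True)
qed

lemma well_poised_trivial: "well_poised 0 0 0 = - (Q ^ 3) + Q\<^sup>2 + Q + 1"
proof -
  have "well_poised 0 0 0 = - (Q * (Q - 1) - 1 - Q + Q * (Q - 1)\<^sup>2)"
    using well_poised_double_sum[of 0 0 0] by simp
  also have "\<dots> = - (Q ^ 3) + Q\<^sup>2 + Q + 1"
    by Groebner_Basis.algebra
  finally show ?thesis .
qed

text \<open>C = \<phi> is excluded from \<open>well_poised_double_sum\<close>, so both roots 0 and
  \<phi> of the trivial character are treated directly. The exceptional one is \<phi> in the first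
  part and 0 in the second.\<close>

lemma well_poised_trivial_order_two:
  assumes "\<phi> \<noteq> 0" "\<phi> + \<phi> = 0"
  shows "well_poised 0 0 \<phi> = - (Q\<^sup>2) + 2 * Q + 1"
    and "well_poised 0 \<phi> \<phi> = (- (Q\<^sup>2) + 2 * Q + 1) / Q"
proof -
  have neg: "- \<phi> = \<phi>"
    using assms(2) by (simp add: neg_eq_iff_add_eq_0)
  have odd: "(1 :: 'a) \<noteq> - 1" and roots: "{R. R + R = 0} = {0, \<phi>}"
    using square_roots_order_two[OF assms, of 0 0] by simp_all
  have G2: "G \<phi> * G \<phi> = Q * ev \<phi> (- 1)" and ev2: "ev \<phi> (- 1) * ev \<phi> (- 1) = 1"
    using G_reflection[of \<phi>] assms(1) by (simp_all add: neg)
  have "barnes 0 0 0 \<phi> = G \<phi>"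
    using barnes_neq[of 0 0 \<phi>] assms(1) by simp
  moreover have "barnes \<phi> 0 0 \<phi> = Q * (Q - 1) * ev \<phi> (- 1) - G \<phi> * G \<phi>"
    using barnes_sum[of 0 \<phi>] by (simp add: neg)
  ultimately have "well_poised 0 0 \<phi> =
      (G \<phi> * (- G \<phi> + ev \<phi> (- 1) * G \<phi> * (Q * (Q - 1) * ev \<phi> (- 1) - G \<phi> * G \<phi>))) / (- (G \<phi> * G \<phi>))"
    unfolding well_poised_eq roots using odd assms(1) by (simp add: neg)
  moreover have "x * (- x + f * x * (Q * (Q - 1) * f - x * x)) = (- (Q\<^sup>2) + 2 * Q + 1) * (- (x * x))"
    if "x * x = Q * f" "f * f = 1" for x f
    using that by Groebner_Basis.algebra
  note this[OF G2 ev2]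
  ultimately show "well_poised 0 0 \<phi> = - (Q\<^sup>2) + 2 * Q + 1"
    by (simp only: nonzero_mult_div_cancel_right neg_equal_0_iff_equal mult_eq_0_iff G_neq_0 disj_absorb not_False_eq_True)
  have "barnes 0 0 \<phi> \<phi> = Q * (Q - 1) - G \<phi> * G \<phi> * G \<phi> * G \<phi>"
    using barnes_sum[of \<phi> \<phi>] by (simp add: neg assms(2))
  moreover have "barnes \<phi> 0 \<phi> \<phi> = G \<phi>"
    using barnes_neq[of \<phi> \<phi> \<phi>] assms by (simp add: neg)
  ultimately have "well_poised 0 \<phi> \<phi> =
      (Q * (Q - 1) - G \<phi> * G \<phi> * G \<phi> * G \<phi> - ev \<phi> (- 1) * G \<phi> * G \<phi> + Q * (Q - 1)\<^sup>2)
      / (- (G \<phi> * G \<phi> * G \<phi> * G \<phi>))"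
    unfolding well_poised_eq roots using odd assms by (simp add: neg)
  \<comment> \<open>The factor \<open>Q\<close> clears the denominator of the value, which keeps the
    identity polynomial.\<close>
  moreover have "Q * (Q * (Q - 1) - x * x * x * x - f * x * x + Q * (Q - 1)\<^sup>2) =
      (- (Q\<^sup>2) + 2 * Q + 1) * (- (x * x * x * x))"
    if "x * x = Q * f" "f * f = 1" for x f
    using that by Groebner_Basis.algebra
  note this[OF G2 ev2]
  ultimately have "Q * well_poised 0 \<phi> \<phi> = - (Q\<^sup>2) + 2 * Q + 1"
    by (simp only: times_divide_eq_right nonzero_mult_div_cancel_right neg_equal_0_iff_equal mult_eq_0_iff
        G_neq_0 disj_absorb not_False_eq_True)
  then show "well_poised 0 \<phi> \<phi> = (- (Q\<^sup>2) + 2 * Q + 1) / Q"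
    by (simp add: eq_divide_eq mult.commute)
qed

end

section \<open>Transfer to characters as functions\<close>

lemma odd_card_imp_1_neq_minus_1:
  assumes "odd CARD('a::{field,finite})"
  shows "(1 :: 'a) \<noteq> - 1"
proof
  assume "(1 :: 'a) = - 1"
  then have 2: "(1 :: 'a) + 1 = 0"
    by (metis add.right_inverse)
  \<comment> \<open>Translation by 1 permutes the field, hence q times 1 is 0; for odd q and 1 + 1 =
    0 it would be 1.\<close>
  have "(\<Sum>x\<in>UNIV. 1 + x) = (\<Sum>x\<in>UNIV. x :: 'a)"
    by (rule sum_translate)
  then have "of_nat CARD('a) = (0 :: 'a)"
    by (simp add: sum.distrib)
  moreover obtain k where "CARD('a) = k + k + 1"
    using assms by (metis oddE mult_2)
  moreover have "of_nat (k + k) = (0 :: 'a)"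
    using 2 by (metis distrib_left mult_1_right mult_zero_right of_nat_add)
  ultimately have "0 + 1 = (0 :: 'a)"
    by (metis of_nat_1 of_nat_add)
  then show False
    by simp
qed

text \<open>Oddness is explicit in (ii), since in characteristic two \<open>well_poised_eq\<close>
  has a further term. Quantifying over \<phi> makes (iv) and (vi) vacuous for even q, and in (iii)
  the negated \<open>order_two_char\<close> expresses that B is not \<phi>.\<close>

theorem theorem4p2:
  fixes \<theta> A B C :: "'a::{field,finite} \<Rightarrow> complex"
  assumes "nontrivial_add_char \<theta>"
    and "mult_char A" and "mult_char B" and "mult_char C"
  shows
    "let q = (of_nat CARD('a) :: complex);
         g = gauss_sum \<theta>;
         F = hyp_3F2_star \<theta> A B C (A \<cdot>\<^sub>c char_inv B) (A \<cdot>\<^sub>c char_inv C) 1;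
         BC = B \<cdot>\<^sub>c C
     in
      (\<not> square_char A \<longrightarrow> F = 0) \<and>
      (odd CARD('a) \<and>
        ((square_char A \<and> BC \<cdot>\<^sub>c BC \<noteq> A) \<or>
         (BC \<cdot>\<^sub>c BC = A \<and> A \<noteq> BC \<and> B \<noteq> \<epsilon> \<and> C \<noteq> \<epsilon>)) \<longrightarrow>
        F = (\<Sum>R | mult_char R \<and> R \<cdot>\<^sub>c R = A.
              (g (char_inv A \<cdot>\<^sub>c B \<cdot>\<^sub>c C) * g (char_inv R \<cdot>\<^sub>c B) * g (char_inv R \<cdot>\<^sub>c C) *
               g R * g (R \<cdot>\<^sub>c char_inv BC)) /
              (g (char_inv A \<cdot>\<^sub>c B) * g (char_inv A \<cdot>\<^sub>c C) * g A * BC (- 1) * q))) \<and>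
      ((BC \<cdot>\<^sub>c BC = A \<and> A \<noteq> BC \<and> A \<noteq> \<epsilon> \<and> (B = \<epsilon> \<or> C = \<epsilon>)) \<or>
       (A = \<epsilon> \<and> C = char_inv B \<and> B \<noteq> \<epsilon> \<and> \<not> order_two_char B) \<longrightarrow>
        F = - q + 3) \<and>
      (\<forall>\<phi>. order_two_char \<phi> \<and> A = \<epsilon> \<and> BC = \<phi> \<and> (B = \<epsilon> \<or> B = \<phi>) \<longrightarrow>
        F = - (q ^ 2) + 2 * q + 1) \<and>
      (A = \<epsilon> \<and> B = \<epsilon> \<and> C = \<epsilon> \<longrightarrow> F = - (q ^ 3) + q ^ 2 + q + 1) \<and>
      (\<forall>\<phi>. order_two_char \<phi> \<and> A = \<epsilon> \<and> B = \<phi> \<and> C = \<phi> \<longrightarrow>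
        F = (- (q ^ 2) + 2 * q + 1) / q)"
proof -
  interpret gauss_sums \<theta> "of_nat CARD('a)"
    using assms(1) by unfold_locales auto
  have lift: "\<exists>x. \<chi> = ev x" if "mult_char \<chi>" for \<chi> :: "'a \<Rightarrow> complex"
    using that by (intro exI[of _ "mchar \<chi>"]) (simp add: mchar_inverse)
  obtain a b c where abc: "A = ev a" "B = ev b" "C = ev c"
    using assms lift by meson
  note char_simps = plus_mchar.rep_eq[symmetric] uminus_mchar.rep_eq[symmetric]
    zero_mchar.rep_eq[symmetric] ev_inject
  have mult_char_ev: "mult_char (ev x)" for x :: "'a mchar"
    using ev[of x] by simp
  have square: "square_char (ev x) \<longleftrightarrow> (\<exists>R. R + R = x)" for x :: "'a mchar"
    unfolding square_char_def using lift mult_char_ev by (metis plus_mchar.rep_eq ev_inject)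
  have order_two: "order_two_char (ev x) \<longleftrightarrow> x \<noteq> 0 \<and> x + x = 0" for x :: "'a mchar"
    by (simp add: order_two_char_def mult_char_ev char_simps)
  have order_two_lift: "\<exists>x. \<phi> = ev x \<and> x \<noteq> 0 \<and> x + x = 0" if "order_two_char \<phi>" for \<phi> :: "'a \<Rightarrow> complex"
    using that lift[of \<phi>] order_two by (auto simp: order_two_char_def)
  have sum_roots: "(\<Sum>R | mult_char R \<and> R \<cdot>\<^sub>c R = ev a. f R) = (\<Sum>R | R + R = a. f (ev R))"
    for f :: "_ \<Rightarrow> complex"
  proof (rule sum.reindex_cong[of ev])
    show "{R. mult_char R \<and> R \<cdot>\<^sub>c R = ev a} = ev ` {R. R + R = a}"
    proof (intro equalityI subsetI)
      fix R assume "R \<in> {R. mult_char R \<and> R \<cdot>\<^sub>c R = ev a}"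
      moreover from this obtain x where "R = ev x"
        using lift by auto
      ultimately show "R \<in> ev ` {R. R + R = a}"
        by (auto simp: char_simps)
    qed (auto simp: mult_char_ev char_simps)
  qed (simp_all add: inj_on_def ev_inject)
  have F: "hyp_3F2_star \<theta> A B C (A \<cdot>\<^sub>c char_inv B) (A \<cdot>\<^sub>c char_inv C) 1 = well_poised a b c"
    by (simp add: abc well_poised_def char_simps)
  have 1: "well_poised a b c = 0" if "\<not> square_char A"
    using that by (intro well_poised_nonsquare) (simp add: abc square)
  have 2: "well_poised a b c = (\<Sum>R | R + R = a.
    (G (b + c - a) * G (b - R) * G (c - R) * G R * G (R - (b + c))) /
    (G (b - a) * G (c - a) * G a * ev (b + c) (- 1) * of_nat CARD('a)))"
    if "odd CARD('a)" "b + c + (b + c) \<noteq> a \<or> b + c + (b + c) = a \<and> a \<noteq> b + c \<and> b \<noteq> 0 \<and> c \<noteq> 0"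
    using odd_card_imp_1_neq_minus_1[OF that(1)] that(2) by (intro well_poised_generic) auto
  \<comment> \<open>Trivial C reduces to trivial B by the symmetry of the series in B and C.\<close>
  have 3: "well_poised a b c = - of_nat CARD('a) + 3"
    if "b + c + (b + c) = a \<and> a \<noteq> b + c \<and> a \<noteq> 0 \<and> (b = 0 \<or> c = 0) \<or>
      a = 0 \<and> c = - b \<and> b \<noteq> 0 \<and> \<not> (b \<noteq> 0 \<and> b + b = 0)"
    using that well_poised_zero_double[of b] well_poised_zero_double[of c]
      well_poised_commute[of "b + b" b 0] well_poised_trivial_inverse[of b] by auto
  have 4: "well_poised a b c = - (of_nat CARD('a))\<^sup>2 + 2 * of_nat CARD('a) + 1"
    if "order_two_char \<phi>" "A = \<epsilon>" "B \<cdot>\<^sub>c C = \<phi>" "B = \<epsilon> \<or> B = \<phi>" for \<phi>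
  proof -
    obtain x where x: "\<phi> = ev x" "x \<noteq> 0" "x + x = 0"
      using order_two_lift \<open>order_two_char \<phi>\<close> by blast
    with that have "a = 0" "b = 0 \<and> c = x \<or> b = x \<and> c = 0"
      by (auto simp: abc char_simps)
    then show ?thesis
      using well_poised_trivial_order_two(1)[OF x(2,3)] well_poised_commute[of 0 x 0] by auto
  qed
  have 6: "well_poised a b c = (- (of_nat CARD('a))\<^sup>2 + 2 * of_nat CARD('a) + 1) / of_nat CARD('a)"
    if "order_two_char \<phi>" "A = \<epsilon>" "B = \<phi>" "C = \<phi>" for \<phi>
  proof -
    obtain x where x: "\<phi> = ev x" "x \<noteq> 0" "x + x = 0"
      using order_two_lift \<open>order_two_char \<phi>\<close> by blast
    with that have "a = 0" "b = x" "c = x"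
      by (auto simp: abc char_simps)
    then show ?thesis
      using well_poised_trivial_order_two(2)[OF x(2,3)] by simp
  qed
  show ?thesis
    unfolding Let_def F
  proof (intro conjI impI allI; (elim conjE)?)
    show "well_poised a b c = 0" if "\<not> square_char A"
      using that by (rule 1)
    show "well_poised a b c = (\<Sum>R | mult_char R \<and> R \<cdot>\<^sub>c R = A.
        (gauss_sum \<theta> (char_inv A \<cdot>\<^sub>c B \<cdot>\<^sub>c C) * gauss_sum \<theta> (char_inv R \<cdot>\<^sub>c B) *
         gauss_sum \<theta> (char_inv R \<cdot>\<^sub>c C) * gauss_sum \<theta> R * gauss_sum \<theta> (R \<cdot>\<^sub>c char_inv (B \<cdot>\<^sub>c C))) /
        (gauss_sum \<theta> (char_inv A \<cdot>\<^sub>c B) * gauss_sum \<theta> (char_inv A \<cdot>\<^sub>c C) * gauss_sum \<theta> A *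
         (B \<cdot>\<^sub>c C) (- 1) * of_nat CARD('a)))"
      if "odd CARD('a)" "square_char A \<and> B \<cdot>\<^sub>c C \<cdot>\<^sub>c (B \<cdot>\<^sub>c C) \<noteq> A \<or>
        B \<cdot>\<^sub>c C \<cdot>\<^sub>c (B \<cdot>\<^sub>c C) = A \<and> A \<noteq> B \<cdot>\<^sub>c C \<and> B \<noteq> \<epsilon> \<and> C \<noteq> \<epsilon>"
    proof -
      have "b + c + (b + c) \<noteq> a \<or> b + c + (b + c) = a \<and> a \<noteq> b + c \<and> b \<noteq> 0 \<and> c \<noteq> 0"
        using that(2) by (auto simp: abc char_simps)
      moreover have "- a + b + c = b + c - a" "- x + y = y - x" for x y :: "'a mchar"
        by simp_all
      ultimately show ?thesis
        unfolding 2[OF that(1) \<open>b + c + (b + c) \<noteq> a \<or> _\<close>] abc sum_roots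
        by (simp only: char_simps G_def add_uminus_conv_diff)
    qed
    show "well_poised a b c = - of_nat CARD('a) + 3"
      if "B \<cdot>\<^sub>c C \<cdot>\<^sub>c (B \<cdot>\<^sub>c C) = A \<and> A \<noteq> B \<cdot>\<^sub>c C \<and> A \<noteq> \<epsilon> \<and> (B = \<epsilon> \<or> C = \<epsilon>) \<or>
        A = \<epsilon> \<and> C = char_inv B \<and> B \<noteq> \<epsilon> \<and> \<not> order_two_char B"
      using that unfolding abc order_two char_simps by (rule 3)
    show "well_poised a b c = - (of_nat CARD('a) ^ 3) + (of_nat CARD('a))\<^sup>2 + of_nat CARD('a) + 1"
      if "A = \<epsilon>" "B = \<epsilon>" "C = \<epsilon>"
      using that well_poised_trivial by (simp add: abc char_simps)
  qed (fact 4 6)+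
qed

end
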